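(* There exists a sense-preserving homeomorphism $h$ of the unit circle $\mathbb S$ onto itself such that $h$ is absolutely continuous, $|h'|$ is a doubling weight, $\log h' \in \mathrm{BMO}(\mathbb S)$, but $|h'|$ is not an $A_\infty$-weight.
   Context: $\mathbb S=\{z\in\mathbb C:|z|=1\}$ is the unit circle; $|\cdot|$ applied to a subset of $\mathbb S$ denotes Lebesgue (arc-length) measure; an interval $I\subset\mathbb S$ is an arc. Derivative and logarithm: for a sense-preserving homeomorphism $h$ of $\mathbb S$, write $h(e^{ix})=e^{ig(x)}$ with $g:\mathbb R\to\mathbb R$ continuous, increasing and $g(x+2\pi)=g(x)+2\pi$. $h$ is absolutely continuous if $g$ is (locally) absolutely continuous. Then, almost everywhere, $|h'(e^{ix})|=g'(x)$ and $\log h'(e^{ix})=\log g'(x)+i(g(x)-x)$. Doubling weight: for an absolutely continuous sense-preserving homeomorphism $h$ of $\mathbb S$, $|h'|$ is called a doubling weight if $h$ is quasisymmetric, i.e. there is a constant $C>0$ such that for any two adjacent intervals $I,I^*\subset\mathbb S$ of length $|I|=|I^*|\le\pi$ one has $C^{-1}|h(I)|\le|h(I^* )|\le C|h(I)|$. $A_\infty$-weight: for an absolutely continuous sense-preserving homeomorphism $h$ of $\mathbb S$, $|h'|$ is called an $A_\infty$-weight if for each $\epsilon>0$ there is $\delta>0$ such that $|E|\le\delta|I|$ implies $|h(E)|\le\epsilon|h(I)|$ whenever $I\subset\mathbb S$ is an interval and $E\subset I$ is a measurable subset. BMO: an integrable (complex-valued) function $u$ on $\mathbb S$ belongs to $\mathrm{BMO}(\mathbb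 S)$ if $\|u\|_*=\sup_{I\subset\mathbb S}\frac1{|I|}\int_I|u(z)-u_I|\,|dz|<\infty$, where the supremum is over all intervals $I\subset\mathbb S$ and $u_I$ is the integral mean of $u$ over $I$. *)

theory Defs
  imports "HOL-Analysis.Analysis"
begin

abbreviation unit_circle :: "complex set" where
  "unit_circle \<equiv> sphere 0 1"

(* cis is injective on [0, 2 pi); the measurable sets are the images of the
   Lebesgue (not only Borel) measurable subsets of that interval. *)
definition arc_length_measure :: "complex measure" where
  "arc_length_measure = embed_measure (lebesgue_on {0..<2 * pi}) cis"

abbreviation arc_length :: "complex set \<Rightarrow> real" where
  "arc_length E \<equiv> measure arc_length_measure E"

(* Arcs are taken closed, nondegenerate and possibly the whole circle. Endpoints
   are null sets, and so are their images under a homeomorphism, so the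
   notions below do not depend on which endpoints belong to an arc. *)
definition circle_interval :: "complex set \<Rightarrow> bool" where
  "circle_interval I \<longleftrightarrow> (\<exists>a b. a < b \<and> b \<le> a + 2 * pi \<and> I = cis ` {a..b})"

(* The second arc follows the first one counterclockwise; the notions below that use
   adjacency are symmetric in the two arcs. *)
definition adjacent_intervals :: "complex set \<Rightarrow> complex set \<Rightarrow> bool" where
  "adjacent_intervals I J \<longleftrightarrow>
     (\<exists>a b c. a < b \<and> b < c \<and> c \<le> a + 2 * pi \<and> I = cis ` {a..b} \<and> J = cis ` {b..c})"

definition angular_lift :: "(complex \<Rightarrow> complex) \<Rightarrow> (real \<Rightarrow> real) \<Rightarrow> bool" where
  "angular_lift h g \<longleftrightarrow>
     continuous_on UNIV g \<and> strict_mono g \<and>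
     (\<forall>x. g (x + 2 * pi) = g x + 2 * pi) \<and>
     (\<forall>x. h (cis x) = cis (g x))"

definition sense_preserving_circle_homeomorphism :: "(complex \<Rightarrow> complex) \<Rightarrow> bool" where
  "sense_preserving_circle_homeomorphism h \<longleftrightarrow>
     (\<exists>k. homeomorphism unit_circle unit_circle h k) \<and> (\<exists>g. angular_lift h g)"

(* The elements k = {Inf k..Sup k} of d are finitely many non-overlapping compact intervals. *)
definition absolutely_continuous_on :: "real set \<Rightarrow> (real \<Rightarrow> real) \<Rightarrow> bool" where
  "absolutely_continuous_on S g \<longleftrightarrow>
     (\<forall>\<epsilon>>0. \<exists>\<delta>>0. \<forall>d T. d division_of T \<and> T \<subseteq> S \<and> (\<Sum>k\<in>d. Sup k - Inf k) < \<delta> \<longrightarrow>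
        (\<Sum>k\<in>d. \<bar>g (Sup k) - g (Inf k)\<bar>) < \<epsilon>)"

(* Any two lifts of h differ by an integer multiple of 2 pi, so the choice of g is immaterial. *)
definition circle_absolutely_continuous :: "(complex \<Rightarrow> complex) \<Rightarrow> bool" where
  "circle_absolutely_continuous h \<longleftrightarrow>
     (\<exists>g. angular_lift h g \<and> (\<forall>a b. absolutely_continuous_on {a..b} g))"

(* u is a version of log h', which is determined up to null sets and up to an additive
   constant in 2 pi i Z. Since ln 0 = 0 in HOL, positivity of the derivative
   has to be demanded explicitly: where g' = 0, log h' is not finite. *)
definition is_log_deriv :: "(complex \<Rightarrow> complex) \<Rightarrow> (complex \<Rightarrow> complex) \<Rightarrow> bool" where
  "is_log_deriv h u \<longleftrightarrow>
     (\<exists>g. angular_lift h g \<and>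
       (AE x in lebesgue. \<exists>d>0. (g has_real_derivative d) (at x) \<and>
          u (cis x) = complex_of_real (ln d) + \<i> * complex_of_real (g x - x)))"

definition quasisymmetric :: "(complex \<Rightarrow> complex) \<Rightarrow> bool" where
  "quasisymmetric h \<longleftrightarrow>
     (\<exists>C>0. \<forall>I J. adjacent_intervals I J \<and> arc_length I = arc_length J \<and> arc_length I \<le> pi \<longrightarrow>
        inverse C * arc_length (h ` I) \<le> arc_length (h ` J) \<and>
        arc_length (h ` J) \<le> C * arc_length (h ` I))"

(* The two weight conditions on |h'| are meant for absolutely continuous sense-preserving
   homeomorphisms h. Such an h maps measurable sets to measurable sets, hence
   arc_length (h ` E) is the integral of |h'| over E. *)
definition deriv_doubling_weight :: "(complex \<Rightarrow> complex) \<Rightarrow> bool" where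
  "deriv_doubling_weight h \<longleftrightarrow> quasisymmetric h"

definition deriv_A_infinity_weight :: "(complex \<Rightarrow> complex) \<Rightarrow> bool" where
  "deriv_A_infinity_weight h \<longleftrightarrow>
     (\<forall>\<epsilon>>0. \<exists>\<delta>>0. \<forall>I E. circle_interval I \<and> E \<in> sets arc_length_measure \<and> E \<subseteq> I \<and>
        arc_length E \<le> \<delta> * arc_length I \<longrightarrow> arc_length (h ` E) \<le> \<epsilon> * arc_length (h ` I))"

definition interval_mean ::
  "complex set \<Rightarrow> (complex \<Rightarrow> 'a::{banach, second_countable_topology}) \<Rightarrow> 'a" where
  "interval_mean I u = set_lebesgue_integral arc_length_measure I u /\<^sub>R arc_length I"

definition BMO_circle :: "(complex \<Rightarrow> complex) set" where
  "BMO_circle = {u. integrable arc_length_measure u \<and>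
     bdd_above ((\<lambda>I. interval_mean I (\<lambda>z. norm (u z - interval_mean I u))) ` Collect circle_interval)}"

end

theory Submission
  imports Defs
begin

text \<open>
  If \<open>log w\<close> has bounded mean oscillation, every interval has a typical value of \<open>log w\<close>, and by
  Jensen's inequality the logarithm of the average of \<open>w\<close> lies above that value. The weight
  \<open>w\<close> is an \<open>A\<^sub>\<infinity>\<close>-weight only if the gap between the two is bounded. Here a weight is built for which
  the gap is unbounded, although neighbouring intervals of equal length have comparable averages and
  nearby typical values.

  Cut the circle into five-adic nodes and give every node an average density \<open>2\<^sup>m 2\<^sup>j\<close>, where \<open>m\<close> is
  the base 2 logarithm of its typical density and \<open>j\<close> its gap. A node with \<open>j = 0\<close> is stopped: there
  the weight is constant. Any other node of a walk keeps \<open>m\<close> and \<open>j\<close> in its two end children, has \<open>j\<close> increased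
  by one in one interior child and decreased by one in the other two interior children; this preserves
  the average density because \<open>1 + 2 + 1/2 + 1/2 + 1 = 5\<close>. The gap has a ceiling \<open>N\<close>: at \<open>j = N\<close> it is
  \<open>m\<close> rather than \<open>j\<close> that increases. A spine of nodes of density one starts such a walk, from \<open>j = 1\<close>,
  for every ceiling \<open>N\<close>.

  Three features of this random walk give the theorem.

  \<^item> End children inherit the density and the typical value of their parent, so two adjacent nodes of
    the same generation differ no more than two siblings do. This yields the doubling condition (\<open>lift_doubling\<close>) and lets the oscillation over an
    arbitrary arc be read off from two adjacent nodes (\<open>log_weight_mean_oscillation\<close>).

  \<^item> For Lebesgue measure the gap drifts downwards. The expected number of increases of \<open>m\<close> below a
    node is at most \<open>2\<^sup>j\<^sup>-\<^sup>N\<close>, hence at most one whatever the ceiling is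
    (\<open>descendant_mean_oscillation_le\<close>): the logarithm of the weight has bounded mean oscillation.
    Below a node with \<open>j = 1\<close> the weight exceeds \<open>2\<^sup>m\<close> on at most the fraction \<open>2\<^sup>1\<^sup>-\<^sup>N\<close> of the length,
    which carries at least half of the mass (\<open>concentrated_node\<close>), so the \<open>A\<^sub>\<infinity>\<close> condition fails.

  \<^item> For the measure with density \<open>w\<close> the gap drifts upwards, but because of the ceiling the walk
    still stops almost surely (\<open>unstopped_density_mean_tendsto_0\<close>). Hence no mass is lost to a singular
    part, and the primitive \<open>lift\<close> of the weight is absolutely continuous with
    the node averages prescribed by the cascade (\<open>has_integral_weight\<close>, \<open>lift_absolutely_continuous\<close>).
\<close>

section \<open>An average-preserving five-adic cascade\<close>

text \<open>In \<open>Walk N j m\<close> the number \<open>N\<close> is the ceiling, \<open>j\<close> the gap and \<open>m\<close> the typical binary logarithm of the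
  density. A spine node carries the ceiling of the walk that it starts. That walk begins with gap one, so
  its \<open>m\<close> is \<open>-1\<close>, to match the density one of the spine.\<close>

datatype state = Spine nat | Walk nat nat int

fun child :: "state \<Rightarrow> nat \<Rightarrow> state" where
  "child (Spine N) i =
     (if i = 1 then Walk N 1 (- 1) else if i = 2 then Spine (Suc N) else Walk N 0 0)"
| "child (Walk N j m) i =
     (if j = 0 \<or> i = 0 \<or> i = 4 then Walk N j m
      else if i = 1 then (if j < N then Walk N (Suc j) m else Walk N j (m + 1))
      else Walk N (j - 1) m)"

fun density_of :: "state \<Rightarrow> real" where
  "density_of (Spine N) = 1"
| "density_of (Walk N j m) = 2 ^ j * 2 powi m"

fun base_of :: "state \<Rightarrow> int" where
  "base_of (Spine N) = 0"
| "base_of (Walk N j m) = m"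

fun stopped :: "state \<Rightarrow> bool" where
  "stopped (Spine N) = False"
| "stopped (Walk N j m) = (j = 0)"

fun admissible :: "state \<Rightarrow> bool" where
  "admissible (Spine N) = (1 \<le> N)"
| "admissible (Walk N j m) = (j \<le> N \<and> - 1 \<le> m)"

lemma sum_lessThan_5: "(\<Sum>i<5. f i) = f 0 + f 1 + f 2 + f 3 + f (4::nat)"
  for f :: "nat \<Rightarrow> 'a::comm_monoid_add"
proof -
  have "{..<5::nat} = {0, 1, 2, 3, 4}"
    by auto
  then show ?thesis
    by (simp add: add.assoc)
qed

lemma admissible_child: "admissible s \<Longrightarrow> admissible (child s i)"
  by (cases s) auto

lemma stopped_child: "stopped s \<Longrightarrow> child s i = s"
  by (cases s) auto

lemma density_of_pos: "0 < density_of s"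
  by (cases s) auto

lemma density_of_stopped: "stopped s \<Longrightarrow> density_of s = 2 powi base_of s"
  by (cases s) auto

lemma density_of_eq_mean_child: "(\<Sum>i<5. density_of (child s i)) = 5 * density_of s"
proof (cases s)
  case (Spine N)
  then show ?thesis
    by (simp add: sum_lessThan_5)
next
  case (Walk N j m)
  then show ?thesis
    by (cases j) (auto simp: sum_lessThan_5 power_int_add)
qed

text \<open>The end children repeat the density and the typical value of their parent, so the comparison of two adjacent nodes with different parents
  reduces to the comparison of the parents.\<close>

lemma end_child:
  assumes "i = 0 \<or> i = 4"
  shows "density_of (child s i) = density_of s" "base_of (child s i) = base_of s"
  using assms by (cases s; auto)+

lemma density_of_sibling_le:
  assumes "i < 5" "i' < 5"
  shows "density_of (child s i) \<le> 4 * density_of (child s i')"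
proof (cases s)
  case (Walk N j m)
  then show ?thesis
    using assms by (cases j) (auto simp: power_int_add)
qed auto

lemma base_of_sibling_diff:
  assumes "i < 5" "i' < 5"
  shows "\<bar>base_of (child s i) - base_of (child s i')\<bar> \<le> 1"
  using assms by (cases s) auto

section \<open>Nodes\<close>

fun node_state :: "nat \<Rightarrow> int \<Rightarrow> state" where
  "node_state 0 k = Spine 1"
| "node_state (Suc n) k = child (node_state n (k div 5)) (nat (k mod 5))"

lemma admissible_node_state: "admissible (node_state n k)"
  by (induction n arbitrary: k) (auto intro: admissible_child)

lemma node_state_child:
  assumes "i < 5"
  shows "node_state (Suc n) (5 * k + int i) = child (node_state n k) i"
  using assms by simp

lemma node_state_periodic: "node_state n (k + 5 ^ n) = node_state n k"
proof (induction n arbitrary: k)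
  case (Suc n)
  have "(k + 5 ^ Suc n) div 5 = k div 5 + 5 ^ n" "(k + 5 ^ Suc n) mod 5 = k mod 5"
    by simp_all
  then show ?case
    using Suc[of "k div 5"] by (simp add: add.commute)
qed simp

lemma node_state_parent_cases:
  obtains k' i where "i < 4" "k = 5 * k' + int i" "k + 1 = 5 * k' + int (Suc i)"
  | k' where "k = 5 * k' + int 4" "k + 1 = 5 * (k' + 1) + int 0"
proof (cases "k mod 5 = 4")
  case True
  then have "k = 5 * (k div 5) + 4"
    by presburger
  then show ?thesis
    using that(2)[of "k div 5"] by simp
next
  case False
  then have "nat (k mod 5) < 4" "k = 5 * (k div 5) + int (nat (k mod 5))"
    by auto
  then show ?thesis
    using that(1)[of "nat (k mod 5)" "k div 5"] by simp
qed

text \<open>Two adjacent nodes are either siblings, or end children of adjacent parents, whose data they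
  inherit.\<close>

lemma density_of_neighbour_le:
  "density_of (node_state n k) \<le> 4 * density_of (node_state n (k + 1)) \<and>
   density_of (node_state n (k + 1)) \<le> 4 * density_of (node_state n k)"
proof (induction n arbitrary: k)
  case (Suc n)
  show ?case
  proof (cases k rule: node_state_parent_cases)
    case (1 k' i)
    then show ?thesis
      using node_state_child[of i n k'] node_state_child[of "Suc i" n k']
      by (simp only:) (auto intro: density_of_sibling_le)
  next
    case (2 k')
    then show ?thesis
      using node_state_child[of 4 n k'] node_state_child[of 0 n "k' + 1"] Suc[of k']
        end_child[of 4 "node_state n k'"] end_child[of 0 "node_state n (k' + 1)"]
      by (simp only:) auto
  qed
qed simp

lemma base_of_neighbour_diff:
  "\<bar>base_of (node_state n k) - base_of (node_state n (k + 1))\<bar> \<le> 1"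
proof (induction n arbitrary: k)
  case (Suc n)
  show ?case
  proof (cases k rule: node_state_parent_cases)
    case (1 k' i)
    then show ?thesis
      using node_state_child[of i n k'] node_state_child[of "Suc i" n k']
      by (simp only:) (auto intro: base_of_sibling_diff)
  next
    case (2 k')
    then show ?thesis
      using node_state_child[of 4 n k'] node_state_child[of 0 n "k' + 1"] Suc[of k']
        end_child[of 4 "node_state n k'"] end_child[of 0 "node_state n (k' + 1)"]
      by (simp only:) auto
  qed
qed simp

lemma spine_exists: "\<exists>k. node_state n k = Spine (Suc n)"
proof (induction n)
  case (Suc n)
  then obtain k where "node_state n k = Spine (Suc n)"
    by blast
  then have "node_state (Suc n) (5 * k + int 2) = Spine (Suc (Suc n))"
    by (subst node_state_child) auto
  then show ?case
    by blast
qed simp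

text \<open>A walk with ceiling \<open>N\<close> refutes the \<open>A\<^sub>\<infinity>\<close> condition for \<open>\<delta>\<close> above about \<open>2\<^sup>1\<^sup>-\<^sup>N\<close>; arbitrarily high
  ceilings are there to deal with every \<open>\<delta>\<close>.\<close>

lemma walk_exists: "\<exists>n k. node_state n k = Walk (Suc N) 1 (- 1)"
proof -
  obtain k where "node_state N k = Spine (Suc N)"
    using spine_exists by blast
  then have "node_state (Suc N) (5 * k + int 1) = Walk (Suc N) 1 (- 1)"
    by (subst node_state_child) auto
  then show ?thesis
    by blast
qed

section \<open>Means over descendants\<close>

text \<open>The expectation of \<open>F\<close> at time \<open>r\<close> of the random walk that starts in \<open>s\<close> and moves to a uniformly
  chosen child, as Lebesgue measure does.\<close>

fun descendant_mean :: "nat \<Rightarrow> (state \<Rightarrow> real) \<Rightarrow> state \<Rightarrow> real" where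
  "descendant_mean 0 F s = F s"
| "descendant_mean (Suc r) F s = (\<Sum>i<5. descendant_mean r F (child s i)) / 5"

lemma descendant_mean_mono:
  assumes "admissible s" "\<And>s. admissible s \<Longrightarrow> F s \<le> G s"
  shows "descendant_mean r F s \<le> descendant_mean r G s"
  using assms(1)
  by (induction r arbitrary: s) (auto intro!: assms(2) sum_mono divide_right_mono admissible_child)

lemma descendant_mean_add:
  "descendant_mean r (\<lambda>s. F s + G s) s = descendant_mean r F s + descendant_mean r G s"
  by (induction r arbitrary: s) (auto simp: sum.distrib add_divide_distrib)

text \<open>The means of a superharmonic function decrease; every estimate on the cascade comes from a
  suitable choice of \<open>F\<close>.\<close>

lemma descendant_mean_le_superharmonic:
  assumes "admissible s"
    and "\<And>s. admissible s \<Longrightarrow> (\<Sum>i<5. F (child s i)) / 5 \<le> F s"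
  shows "descendant_mean r F s \<le> F s"
  using assms(1)
proof (induction r arbitrary: s)
  case (Suc r)
  have "descendant_mean (Suc r) F s \<le> (\<Sum>i<5. F (child s i)) / 5"
    using Suc by (auto intro!: sum_mono divide_right_mono admissible_child)
  also have "\<dots> \<le> F s"
    using assms(2) Suc.prems by blast
  finally show ?case .
qed simp

lemma descendant_mean_density_of: "descendant_mean r density_of s = density_of s"
  by (induction r arbitrary: s) (simp_all add: density_of_eq_mean_child)

section \<open>Termination\<close>

definition unstopped_density :: "state \<Rightarrow> real" where
  "unstopped_density s = (if stopped s then 0 else density_of s)"

text \<open>Density times the expected stopping time of the walk under the measure with density \<open>w\<close>. For that
  measure a walk below its ceiling has \<open>j\<close> increased with probability \<open>2/5\<close> and decreased with probability
  \<open>1/5\<close>; at the ceiling it stays with probability \<open>4/5\<close>. Solving the recurrence gives the expected time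
  \<open>10 (2\<^sup>N - 2\<^sup>N\<^sup>-\<^sup>j) - 5 j\<close>. On the spine an upper bound suffices: the time grows like \<open>2\<^sup>N\<close>, but the
  ceiling increases only with probability \<open>1/5\<close>.\<close>

fun termination_potential :: "state \<Rightarrow> real" where
  "termination_potential (Spine N) = 2 * 2 ^ N"
| "termination_potential (Walk N j m) = 2 powi m * (10 * 2 ^ N * (2 ^ j - 1) - 5 * j * 2 ^ j)"

lemma termination_potential_nonneg:
  assumes "admissible s"
  shows "0 \<le> termination_potential s"
proof (cases s)
  case (Walk N j m)
  have "5 * real j * 2 ^ j \<le> 10 * 2 ^ N * (2 ^ j - 1)"
  proof (cases j)
    case (Suc i)
    have "real j \<le> 2 ^ j"
      using less_exp[of j] by (metis less_imp_le of_nat_le_iff of_nat_numeral of_nat_power)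
    also have "(2::real) ^ j \<le> 2 ^ N"
      using assms Walk by simp
    finally have "5 * real j * 2 ^ j \<le> 5 * 2 ^ N * (2::real) ^ j"
      by simp
    also have "\<dots> \<le> 5 * 2 ^ N * (2 * (2 ^ j - 1))"
      using Suc by (intro mult_left_mono) auto
    finally show ?thesis
      by (simp add: algebra_simps)
  qed simp
  then show ?thesis
    using Walk by simp
qed simp

lemma termination_potential_drift:
  assumes "admissible s"
  shows "(\<Sum>i<5. termination_potential (child s i)) / 5 + unstopped_density s
           \<le> termination_potential s"
proof (cases s)
  case (Spine N)
  then show ?thesis
    by (simp add: sum_lessThan_5 unstopped_density_def power_int_minus algebra_simps)
      (simp add: field_simps)
next
  case (Walk N j m)
  show ?thesis
  proof (cases j)
    case 0
    then show ?thesis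
      using Walk by (simp add: sum_lessThan_5 unstopped_density_def)
  next
    case (Suc i)
    show ?thesis
    proof (cases "j < N")
      case True
      then show ?thesis
        using Walk Suc by (simp add: sum_lessThan_5 unstopped_density_def field_simps)
    next
      case False
      then have "N = Suc i"
        using Walk Suc assms by simp
      then show ?thesis
        using Walk Suc
        by (simp add: sum_lessThan_5 unstopped_density_def power_int_add field_simps)
    qed
  qed
qed

lemma unstopped_density_mean_child_le:
  "(\<Sum>i<5. unstopped_density (child s i)) / 5 \<le> unstopped_density s"
proof (cases "stopped s")
  case True
  then show ?thesis
    by (simp add: unstopped_density_def stopped_child)
next
  case False
  have "(\<Sum>i<5. unstopped_density (child s i)) \<le> (\<Sum>i<5. density_of (child s i))"
    using density_of_pos by (intro sum_mono) (auto simp: unstopped_density_def less_imp_le)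
  then show ?thesis
    using False density_of_eq_mean_child[of s] by (simp add: unstopped_density_def)
qed

text \<open>The mass of the unstopped nodes decreases with the generation, and the potential bounds the sum of
  these masses over all generations; so the mass at generation \<open>r\<close> is at most the potential divided by
  \<open>r + 1\<close>.\<close>

lemma unstopped_density_decay:
  assumes "admissible s"
  shows "(real r + 1) * descendant_mean r unstopped_density s \<le> termination_potential s"
  using assms
proof (induction r arbitrary: s)
  case 0
  have "0 \<le> (\<Sum>i<5. termination_potential (child s i)) / 5"
    using 0 by (auto intro!: sum_nonneg termination_potential_nonneg admissible_child)
  then show ?case
    using termination_potential_drift[OF 0] by simp
next
  case (Suc r)
  have "(real (Suc r) + 1) * descendant_mean (Suc r) unstopped_density s =
      (\<Sum>i<5. (real r + 1) * descendant_mean r unstopped_density (child s i)) / 5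
      + descendant_mean (Suc r) unstopped_density s"
    by (simp add: field_simps sum.distrib sum_distrib_left)
  also have "\<dots> \<le> (\<Sum>i<5. termination_potential (child s i)) / 5 + unstopped_density s"
    by (intro add_mono divide_right_mono sum_mono Suc.IH admissible_child Suc.prems
        descendant_mean_le_superharmonic unstopped_density_mean_child_le) auto
  also have "\<dots> \<le> termination_potential s"
    using termination_potential_drift Suc.prems by blast
  finally show ?case .
qed

lemma unstopped_density_mean_tendsto_0:
  assumes "admissible s"
  shows "(\<lambda>r. descendant_mean r unstopped_density s) \<longlonglongrightarrow> 0"
proof (rule tendsto_sandwich)
  show "\<forall>\<^sub>F r in sequentially. 0 \<le> descendant_mean r unstopped_density s"
  proof (rule always_eventually, rule allI)
    fix r
    have "0 \<le> descendant_mean r unstopped_density s" for s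
      by (induction r arbitrary: s)
        (auto simp: unstopped_density_def density_of_pos less_imp_le intro!: sum_nonneg)
    then show "0 \<le> descendant_mean r unstopped_density s" .
  qed
  show "\<forall>\<^sub>F r in sequentially.
      descendant_mean r unstopped_density s \<le> termination_potential s * inverse (real (Suc r))"
    using unstopped_density_decay[OF assms]
    by (intro always_eventually allI) (simp add: field_simps)
  show "(\<lambda>r. termination_potential s * inverse (real (Suc r))) \<longlonglongrightarrow> 0"
    using tendsto_mult_right_zero[OF LIMSEQ_inverse_real_of_nat] by simp
qed auto

text \<open>An unstopped walk has \<open>m \<ge> -1\<close> and \<open>j \<ge> 1\<close>. Hence the length of the unstopped nodes is controlled by
  their mass, and both tend to zero.\<close>

lemma density_of_unstopped_ge_1:
  assumes "admissible s" "\<not> stopped s"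
  shows "1 \<le> density_of s"
proof (cases s)
  case (Walk N j m)
  have "(2::real) powi - 1 \<le> 2 powi m"
    using assms Walk by (intro power_int_increasing) auto
  moreover have "(2::real) ^ 1 \<le> 2 ^ j"
    using assms Walk by (intro power_increasing) auto
  ultimately have "2 * (1 / 2) \<le> (2::real) ^ j * 2 powi m"
    by (intro mult_mono) (auto simp: power_int_minus)
  then show ?thesis
    using Walk by simp
qed simp

lemma unstopped_mean_tendsto_0:
  assumes "admissible s"
  shows "(\<lambda>r. descendant_mean r (\<lambda>s. of_bool (\<not> stopped s)) s) \<longlonglongrightarrow> 0"
proof (rule tendsto_sandwich[OF _ _ tendsto_const unstopped_density_mean_tendsto_0[OF assms]])
  have "0 \<le> descendant_mean r (\<lambda>s. of_bool (\<not> stopped s)) s" for r s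
    by (induction r arbitrary: s) (auto intro!: sum_nonneg)
  then show "\<forall>\<^sub>F r in sequentially. 0 \<le> descendant_mean r (\<lambda>s. of_bool (\<not> stopped s)) s"
    by simp
  show "\<forall>\<^sub>F r in sequentially. descendant_mean r (\<lambda>s. of_bool (\<not> stopped s)) s
      \<le> descendant_mean r unstopped_density s"
    using assms density_of_unstopped_ge_1
    by (intro always_eventually allI descendant_mean_mono) (auto simp: unstopped_density_def)
qed

section \<open>Oscillation\<close>

text \<open>The function \<open>2\<^sup>j\<^sup>-\<^sup>N\<close> solves the recurrence for the expected number of increases of \<open>m\<close>: it is
  harmonic for the walk below the ceiling, and at the ceiling its loss is exactly the probability \<open>1/5\<close>
  of an increase.\<close>

fun oscillation_potential :: "state \<Rightarrow> real" where
  "oscillation_potential (Spine N) = 1"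
| "oscillation_potential (Walk N j m) = 2 ^ j / 2 ^ N"

lemma oscillation_potential_nonneg: "0 \<le> oscillation_potential s"
  by (cases s) auto

lemma oscillation_potential_le_1: "admissible s \<Longrightarrow> oscillation_potential s \<le> 1"
  by (cases s) auto

lemma oscillation_potential_drift:
  assumes "admissible s"
  shows "(\<Sum>i<5. \<bar>real_of_int (base_of (child s i)) - base_of s\<bar> + oscillation_potential (child s i))
           \<le> 5 * oscillation_potential s"
proof (cases s)
  case (Spine N)
  then have "(2::real) ^ 1 \<le> 2 ^ N"
    using assms by (intro power_increasing) auto
  then show ?thesis
    using Spine by (simp add: sum_lessThan_5 field_simps)
next
  case (Walk N j m)
  show ?thesis
  proof (cases j)
    case 0
    then show ?thesis
      using Walk by (simp add: sum_lessThan_5)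
  next
    case (Suc i)
    show ?thesis
    proof (cases "j < N")
      case True
      then show ?thesis
        using Walk Suc by (simp add: sum_lessThan_5 field_simps)
    next
      case False
      then have "N = Suc i"
        using Walk Suc assms by simp
      then show ?thesis
        using Walk Suc by (simp add: sum_lessThan_5 field_simps)
    qed
  qed
qed

text \<open>By the triangle inequality, adding the potential to the distance from the initial value of \<open>m\<close> gives
  a superharmonic function.\<close>

lemma descendant_mean_oscillation_le:
  assumes "admissible s"
  shows "descendant_mean r (\<lambda>s'. \<bar>real_of_int (base_of s') - base_of s\<bar>) s \<le> oscillation_potential s"
proof -
  define c where "c = real_of_int (base_of s)"
  define F where "F = (\<lambda>s'. \<bar>real_of_int (base_of s') - c\<bar> + oscillation_potential s')"
  have F: "(\<Sum>i<5. F (child s i)) / 5 \<le> F s" if "admissible s" for s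
  proof -
    have "(\<Sum>i<5. F (child s i)) \<le> (\<Sum>i<5::nat. \<bar>real_of_int (base_of s) - c\<bar>
        + (\<bar>real_of_int (base_of (child s i)) - base_of s\<bar> + oscillation_potential (child s i)))"
      unfolding F_def by (intro sum_mono) auto
    also have "\<dots> \<le> 5 * F s"
      unfolding sum.distrib[of "\<lambda>_. \<bar>real_of_int (base_of s) - c\<bar>"]
      using oscillation_potential_drift[OF that] by (simp add: F_def)
    finally show ?thesis
      by simp
  qed
  have "descendant_mean r (\<lambda>s'. \<bar>real_of_int (base_of s') - c\<bar>) s \<le> descendant_mean r F s"
    using assms by (intro descendant_mean_mono) (auto simp: F_def oscillation_potential_nonneg)
  also have "\<dots> \<le> F s"
    using descendant_mean_le_superharmonic[OF assms F] .
  finally show ?thesis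
    by (simp add: F_def c_def)
qed

section \<open>The weight carried by the five-adic nodes\<close>

text \<open>The nodes \<open>[grid n k, grid n (k + 1))\<close> run over the whole real line, with one period of length
  \<open>2 \<pi>\<close> as node of generation zero; adjacency across the angle zero then needs no separate treatment.\<close>

definition grid :: "nat \<Rightarrow> int \<Rightarrow> real" where
  "grid n k = 2 * pi * of_int k / 5 ^ n"

definition node_index :: "nat \<Rightarrow> real \<Rightarrow> int" where
  "node_index n x = \<lfloor>5 ^ n * x / (2 * pi)\<rfloor>"

definition state_at :: "nat \<Rightarrow> real \<Rightarrow> state" where
  "state_at n x = node_state n (node_index n x)"

text \<open>Almost every point lies in a stopped node, where the sequence is eventually constant. On the remaining
  null set the value of the limit does not matter, but as a limit the function is measurable.\<close>

definition log_weight :: "real \<Rightarrow> real" where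
  "log_weight x = lim (\<lambda>n. real_of_int (base_of (state_at n x)))"

definition weight :: "real \<Rightarrow> real" where
  "weight x = 2 powr log_weight x"

lemma grid_less_iff: "grid n k < grid n l \<longleftrightarrow> k < l"
  by (simp add: grid_def field_simps)

lemma grid_le_iff: "grid n k \<le> grid n l \<longleftrightarrow> k \<le> l"
  by (simp add: grid_def field_simps)

lemma grid_Suc: "grid (Suc n) (5 * k) = grid n k"
  by (simp add: grid_def)

lemma grid_diff: "grid n l - grid n k = 2 * pi / 5 ^ n * (l - k)"
  by (simp add: grid_def field_simps)

lemma node_index_eq_iff: "node_index n x = k \<longleftrightarrow> grid n k \<le> x \<and> x < grid n (k + 1)"
  by (simp add: node_index_def grid_def floor_eq_iff field_simps)

lemma grid_node_index: "grid n (node_index n x) \<le> x" "x < grid n (node_index n x + 1)"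
  using node_index_eq_iff[of n x "node_index n x"] by simp_all

lemma node_index_Suc: "node_index (Suc n) x div 5 = node_index n x"
proof -
  have "node_index n x = \<lfloor>5 ^ Suc n * x / (2 * pi) / real_of_int 5\<rfloor>"
    by (simp add: node_index_def mult.commute)
  then show ?thesis
    unfolding node_index_def by (subst (asm) floor_divide_real_eq_div) simp_all
qed

lemma node_index_periodic: "node_index n (x + 2 * pi) = node_index n x + 5 ^ n"
proof -
  have "5 ^ n * (x + 2 * pi) / (2 * pi) = 5 ^ n * x / (2 * pi) + of_int (5 ^ n)"
    by (simp add: field_simps)
  then show ?thesis
    unfolding node_index_def by (simp only: floor_add_int)
qed

lemma state_at_eq: "grid n k \<le> x \<Longrightarrow> x < grid n (k + 1) \<Longrightarrow> state_at n x = node_state n k"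
  using node_index_eq_iff unfolding state_at_def by metis

lemma state_at_periodic: "state_at n (x + 2 * pi) = state_at n x"
  by (simp add: state_at_def node_index_periodic node_state_periodic)

lemma state_at_Suc: "\<exists>i<5. state_at (Suc n) x = child (state_at n x) i"
  by (auto simp: state_at_def node_index_Suc intro!: exI[of _ "nat (node_index (Suc n) x mod 5)"])

text \<open>A stopped node passes its state to all its descendants, so \<open>log_weight\<close> and \<open>weight\<close> are constant on
  it.\<close>

lemma state_at_stopped:
  assumes "stopped (state_at n x)" "n \<le> r"
  shows "state_at r x = state_at n x"
  using assms(2)
proof (induction r rule: dec_induct)
  case (step r)
  then show ?case
    using state_at_Suc[of r x] assms(1) by (auto simp: stopped_child)
qed simp

lemma log_weight_stopped:
  assumes "stopped (state_at n x)"
  shows "log_weight x = base_of (state_at n x)"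
proof -
  have "(\<lambda>r. real_of_int (base_of (state_at r x))) \<longlonglongrightarrow> base_of (state_at n x)"
    by (intro tendsto_eventually eventually_sequentiallyI[of n])
      (metis state_at_stopped[OF assms])
  then show ?thesis
    unfolding log_weight_def by (rule limI)
qed

lemma weight_stopped:
  assumes "stopped (state_at n x)"
  shows "weight x = density_of (state_at n x)"
  by (simp add: weight_def log_weight_stopped[OF assms] density_of_stopped[OF assms]
      powr_real_of_int')

lemma weight_pos: "0 < weight x"
  by (simp add: weight_def)

lemma log_weight_periodic: "log_weight (x + 2 * pi) = log_weight x"
  by (simp add: log_weight_def state_at_periodic)

lemma weight_periodic: "weight (x + 2 * pi) = weight x"
  by (simp add: weight_def log_weight_periodic)

lemma measurable_state_at [measurable]: "state_at n \<in> borel \<rightarrow>\<^sub>M count_space UNIV"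
proof -
  have "node_index n \<in> borel \<rightarrow>\<^sub>M count_space UNIV"
    unfolding node_index_def by measurable
  then show ?thesis
    unfolding state_at_def by (rule measurable_compose) simp
qed

lemma measurable_of_state_at [measurable]:
  "(\<lambda>x. F (state_at n x)) \<in> borel \<rightarrow>\<^sub>M borel" for F :: "state \<Rightarrow> real"
  by (rule measurable_compose[OF measurable_state_at]) simp

lemma measurable_log_weight [measurable]: "log_weight \<in> borel_measurable borel"
  unfolding log_weight_def by measurable

lemma measurable_weight [measurable]: "weight \<in> borel_measurable borel"
  unfolding weight_def by measurable

section \<open>Integrals over nodes\<close>

lemma has_integral_grid:
  fixes f :: "real \<Rightarrow> real"
  assumes "\<And>i. i < m \<Longrightarrow> (f has_integral c i) {grid n (k + int i)..grid n (k + int i + 1)}"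
  shows "(f has_integral (\<Sum>i<m. c i)) {grid n k..grid n (k + int m)}"
  using assms
proof (induction m)
  case (Suc m)
  have "(f has_integral (\<Sum>i<m. c i) + c m) {grid n k..grid n (k + int m + 1)}"
    using Suc by (intro has_integral_combine[of _ "grid n (k + int m)"]) (auto simp: grid_le_iff)
  then show ?case
    by (simp add: algebra_simps)
qed (simp add: has_integral_refl)

text \<open>This turns means over descendants into integrals over a node.\<close>

lemma has_integral_state_at:
  "((\<lambda>x. F (state_at (n + r) x)) has_integral 2 * pi / 5 ^ n * descendant_mean r F (node_state n k))
     {grid n k..grid n (k + 1)}"
proof (induction r arbitrary: n k)
  case 0
  have "((\<lambda>x. F (node_state n k)) has_integral (grid n (k + 1) - grid n k) * F (node_state n k))
      {grid n k..grid n (k + 1)}"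
    using has_integral_const_real[of "F (node_state n k)" "grid n k" "grid n (k + 1)"]
    by (simp add: grid_le_iff)
  then have "((\<lambda>x. F (state_at n x)) has_integral (grid n (k + 1) - grid n k) * F (node_state n k))
      {grid n k..grid n (k + 1)}"
    by (rule has_integral_spike_finite[rotated -1, where S = "{grid n (k + 1)}"])
      (auto simp: state_at_eq)
  then show ?case
    by (simp add: grid_diff)
next
  case (Suc r)
  have *: "((\<lambda>x. F (state_at (Suc n + r) x)) has_integral
      (\<Sum>i<5. 2 * pi / 5 ^ Suc n * descendant_mean r F (child (node_state n k) i)))
      {grid (Suc n) (5 * k)..grid (Suc n) (5 * k + int 5)}"
  proof (rule has_integral_grid)
    fix i :: nat
    assume "i < 5"
    then show "((\<lambda>x. F (state_at (Suc n + r) x)) has_integral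
        2 * pi / 5 ^ Suc n * descendant_mean r F (child (node_state n k) i))
        {grid (Suc n) (5 * k + int i)..grid (Suc n) (5 * k + int i + 1)}"
      using Suc[of "Suc n" "5 * k + int i"] by (simp only: node_state_child)
  qed
  have "grid (Suc n) (5 * k + int 5) = grid n (k + 1)"
    using grid_Suc[of n "k + 1"] by (simp add: algebra_simps)
  moreover have "(\<Sum>i<5. 2 * pi / 5 ^ Suc n * descendant_mean r F (child (node_state n k) i)) =
      2 * pi / 5 ^ n * descendant_mean (Suc r) F (node_state n k)"
    by (simp add: sum_distrib_left mult.commute sum_divide_distrib)
  ultimately show ?case
    using * by (simp add: grid_Suc)
qed

lemma nn_integral_state_at:
  assumes "\<And>s. 0 \<le> F s"
  shows "(\<integral>\<^sup>+x. ennreal (F (state_at (n + r) x)) * indicator {grid n k..grid n (k + 1)} x \<partial>lborel) =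
    ennreal (2 * pi / 5 ^ n * descendant_mean r F (node_state n k))"
  using assms has_integral_state_at by (intro nn_integral_has_integral_lebesgue') auto

text \<open>The part of a node that is never stopped is contained in the unstopped descendants of each
  generation, whose length tends to zero.\<close>

lemma AE_stopped: "AE x in lborel. \<exists>n. stopped (state_at n x)"
proof (rule AE_I')
  define Z where "Z k = {x \<in> {grid 0 k..grid 0 (k + 1)}. \<forall>n. \<not> stopped (state_at n x)}" for k
  have [measurable]: "Measurable.pred borel (\<lambda>x. stopped (state_at n x))" for n
    by (rule measurable_compose[OF measurable_state_at]) simp
  have Z [measurable]: "Z k \<in> sets borel" for k
    unfolding Z_def by measurable
  have "emeasure lborel (Z k) = 0" for k
  proof -
    have le: "emeasure lborel (Z k) \<le>
        ennreal (2 * pi * descendant_mean r (\<lambda>s. of_bool (\<not> stopped s)) (node_state 0 k))" for r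
    proof -
      have "emeasure lborel (Z k) = (\<integral>\<^sup>+x. indicator (Z k) x \<partial>lborel)"
        by simp
      also have "\<dots> \<le> (\<integral>\<^sup>+x. ennreal (of_bool (\<not> stopped (state_at (0 + r) x))) *
          indicator {grid 0 k..grid 0 (k + 1)} x \<partial>lborel)"
        by (intro nn_integral_mono) (auto simp: Z_def indicator_def)
      also have "\<dots> = ennreal (2 * pi / 5 ^ 0 *
          descendant_mean r (\<lambda>s. of_bool (\<not> stopped s)) (node_state 0 k))"
        by (rule nn_integral_state_at) simp
      finally show ?thesis
        by simp
    qed
    have "(\<lambda>r. ennreal (2 * pi * descendant_mean r (\<lambda>s. of_bool (\<not> stopped s)) (node_state 0 k)))
        \<longlonglongrightarrow> ennreal (2 * pi * 0)"
      by (intro tendsto_ennrealI tendsto_mult tendsto_const unstopped_mean_tendsto_0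
          admissible_node_state)
    then have "emeasure lborel (Z k) \<le> ennreal (2 * pi * 0)"
      by (rule LIMSEQ_le_const) (use le in auto)
    then show ?thesis
      by simp
  qed
  then show "(\<Union>k. Z k) \<in> null_sets lborel"
    using Z by (intro null_sets_UN') (auto simp: null_sets_def)
  show "{x \<in> space lborel. \<not> (\<exists>n. stopped (state_at n x))} \<subseteq> (\<Union>k. Z k)"
  proof
    fix x
    assume "x \<in> {x \<in> space lborel. \<not> (\<exists>n. stopped (state_at n x))}"
    then have "x \<in> Z (node_index 0 x)"
      using grid_node_index[where x = x and n = 0] by (simp add: Z_def)
    then show "x \<in> (\<Union>k. Z k)"
      by blast
  qed
qed

text \<open>Monotone convergence along the stopped parts of successive generations: what they miss of the mass of
  the node is the mass of the unstopped descendants, which tends to zero.\<close>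

lemma nn_integral_weight:
  "(\<integral>\<^sup>+x. ennreal (weight x) * indicator {grid n k..grid n (k + 1)} x \<partial>lborel) =
     ennreal (2 * pi / 5 ^ n * density_of (node_state n k))"
proof -
  define F where "F s = (if stopped s then density_of s else 0)" for s
  define f where "f r x = ennreal (F (state_at (n + r) x)) * indicator {grid n k..grid n (k + 1)} x"
    for r x
  define u where "u x = (if \<exists>r. stopped (state_at r x) then ennreal (weight x) else 0) *
      indicator {grid n k..grid n (k + 1)} x" for x
  have F_nonneg: "0 \<le> F s" for s
    by (simp add: F_def density_of_pos less_imp_le)
  have F_step: "F (state_at r x) \<le> F (state_at r' x)" if "r \<le> r'" for r r' x
    using F_nonneg state_at_stopped[OF _ that] by (cases "stopped (state_at r x)") (auto simp: F_def)
  have F_lim: "(\<lambda>r. ennreal (F (state_at (n + r) x))) \<longlonglongrightarrow>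
      (if \<exists>r. stopped (state_at r x) then ennreal (weight x) else 0)" for x
  proof (cases "\<exists>r. stopped (state_at r x)")
    case True
    then obtain r where r: "stopped (state_at r x)" ..
    have "F (state_at (n + r') x) = weight x" if "r \<le> r'" for r'
      using state_at_stopped[OF r, of "n + r'"] r that by (simp add: F_def weight_stopped)
    then show ?thesis
      using True by (intro tendsto_eventually eventually_sequentiallyI[of r]) auto
  next
    case False
    then show ?thesis
      by (simp add: F_def)
  qed
  have "(\<lambda>r. integral\<^sup>N lborel (f r)) \<longlonglongrightarrow> integral\<^sup>N lborel u"
  proof (rule nn_integral_LIMSEQ)
    show "incseq f"
      using F_step by (auto simp: incseq_def le_fun_def f_def intro!: mult_right_mono ennreal_leI)
    show "f r \<in> borel_measurable lborel" for r
      unfolding f_def by measurable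
    show "(\<lambda>r. f r x) \<longlonglongrightarrow> u x" for x
      using F_lim[of x] by (cases "x \<in> {grid n k..grid n (k + 1)}") (auto simp: f_def u_def)
  qed
  moreover have "integral\<^sup>N lborel (f r) = ennreal (2 * pi / 5 ^ n *
      (density_of (node_state n k) - descendant_mean r unstopped_density (node_state n k)))" for r
  proof -
    have "density_of = (\<lambda>s. F s + unstopped_density s)"
      by (auto simp: F_def unstopped_density_def)
    then have "density_of s = descendant_mean r F s + descendant_mean r unstopped_density s" for s
      using descendant_mean_density_of[of r s] descendant_mean_add[of r F unstopped_density s]
      by metis
    then show ?thesis
      unfolding f_def using F_nonneg by (subst nn_integral_state_at) (auto simp: algebra_simps)
  qed
  moreover have "(\<lambda>r. ennreal (2 * pi / 5 ^ n *
      (density_of (node_state n k) - descendant_mean r unstopped_density (node_state n k))))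
      \<longlonglongrightarrow> ennreal (2 * pi / 5 ^ n * (density_of (node_state n k) - 0))"
    by (intro tendsto_ennrealI tendsto_mult tendsto_diff tendsto_const
        unstopped_density_mean_tendsto_0 admissible_node_state)
  ultimately have "integral\<^sup>N lborel u = ennreal (2 * pi / 5 ^ n * density_of (node_state n k))"
    using LIMSEQ_unique by simp
  moreover have "integral\<^sup>N lborel u =
      (\<integral>\<^sup>+x. ennreal (weight x) * indicator {grid n k..grid n (k + 1)} x \<partial>lborel)"
    using AE_stopped by (intro nn_integral_cong_AE) (auto simp: u_def)
  ultimately show ?thesis
    by simp
qed

lemma has_integral_weight:
  "(weight has_integral 2 * pi / 5 ^ n * density_of (node_state n k)) {grid n k..grid n (k + 1)}"
proof -
  have "((\<lambda>x. if x \<in> {grid n k..grid n (k + 1)} then weight x else 0) has_integral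
      2 * pi / 5 ^ n * density_of (node_state n k)) UNIV"
  proof (rule nn_integral_has_integral)
    have "(\<integral>\<^sup>+x. ennreal (if x \<in> {grid n k..grid n (k + 1)} then weight x else 0) \<partial>lborel) =
        (\<integral>\<^sup>+x. ennreal (weight x) * indicator {grid n k..grid n (k + 1)} x \<partial>lborel)"
      by (intro nn_integral_cong) auto
    then show "(\<integral>\<^sup>+x. ennreal (if x \<in> {grid n k..grid n (k + 1)} then weight x else 0) \<partial>lborel) =
        ennreal (2 * pi / 5 ^ n * density_of (node_state n k))"
      using nn_integral_weight by simp
  qed (auto simp: weight_pos density_of_pos less_imp_le)
  then show ?thesis
    by (simp only: has_integral_restrict_UNIV)
qed

text \<open>By Fatou's lemma the bound for the number of increases of \<open>m\<close>, uniform in the generation, passes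
  to the limit.\<close>

lemma nn_integral_log_weight_oscillation:
  "(\<integral>\<^sup>+x. ennreal \<bar>log_weight x - base_of (node_state n k)\<bar> *
      indicator {grid n k..grid n (k + 1)} x \<partial>lborel) \<le> ennreal (2 * pi / 5 ^ n)"
proof -
  define c where "c = real_of_int (base_of (node_state n k))"
  define u where "u r x = ennreal \<bar>real_of_int (base_of (state_at (n + r) x)) - c\<bar> *
      indicator {grid n k..grid n (k + 1)} x" for r x
  have "AE x in lborel. ennreal \<bar>log_weight x - c\<bar> * indicator {grid n k..grid n (k + 1)} x
      \<le> liminf (\<lambda>r. u r x)"
    using AE_stopped
  proof eventually_elim
    case (elim x)
    then obtain r where r: "stopped (state_at r x)" ..
    have "u r' x = ennreal \<bar>log_weight x - c\<bar> * indicator {grid n k..grid n (k + 1)} x"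
      if "r \<le> r'" for r'
      using state_at_stopped[OF r, of "n + r'"] log_weight_stopped[OF r] that by (simp add: u_def)
    then have "(\<lambda>r. u r x) \<longlonglongrightarrow> ennreal \<bar>log_weight x - c\<bar> * indicator {grid n k..grid n (k + 1)} x"
      by (intro tendsto_eventually eventually_sequentiallyI[of r])
    then show ?case
      by (simp add: lim_imp_Liminf)
  qed
  then have "(\<integral>\<^sup>+x. ennreal \<bar>log_weight x - c\<bar> * indicator {grid n k..grid n (k + 1)} x \<partial>lborel)
      \<le> (\<integral>\<^sup>+x. liminf (\<lambda>r. u r x) \<partial>lborel)"
    by (rule nn_integral_mono_AE)
  also have "\<dots> \<le> liminf (\<lambda>r. integral\<^sup>N lborel (u r))"
    by (rule nn_integral_liminf) (simp add: u_def)
  also have "\<dots> \<le> ennreal (2 * pi / 5 ^ n)"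
  proof -
    have "integral\<^sup>N lborel (u r) \<le> ennreal (2 * pi / 5 ^ n)" for r
    proof -
      have "descendant_mean r (\<lambda>s. \<bar>real_of_int (base_of s) - c\<bar>) (node_state n k) \<le> 1"
        using descendant_mean_oscillation_le[of "node_state n k" r] oscillation_potential_le_1
        by (auto simp: c_def admissible_node_state intro: order_trans)
      then have "2 * pi / 5 ^ n * descendant_mean r (\<lambda>s. \<bar>real_of_int (base_of s) - c\<bar>)
          (node_state n k) \<le> 2 * pi / 5 ^ n * 1"
        by (intro mult_left_mono) auto
      then show ?thesis
        unfolding u_def by (subst nn_integral_state_at) (auto intro: ennreal_leI)
    qed
    then show ?thesis
      by (metis Liminf_le always_eventually sequentially_bot)
  qed
  finally show ?thesis
    by (simp add: c_def)
qed

section \<open>The primitive of the weight\<close>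

definition lift :: "real \<Rightarrow> real" where
  "lift x = integral {0..x} weight - integral {x..0} weight"

lemma weight_integrable: "weight integrable_on {a..b}"
proof -
  obtain K :: nat where K: "max \<bar>a\<bar> \<bar>b\<bar> / (2 * pi) \<le> real K"
    using real_arch_simple by blast
  have "weight integrable_on {grid 0 (- int K)..grid 0 (- int K + int (2 * K))}"
    by (rule has_integral_integrable[OF has_integral_grid[OF has_integral_weight]])
  moreover have "{a..b} \<subseteq> {grid 0 (- int K)..grid 0 (- int K + int (2 * K))}"
    using K by (auto simp: grid_def field_simps)
  ultimately show ?thesis
    by (rule integrable_on_subinterval)
qed

lemma lift_has_integral:
  assumes "a \<le> b"
  shows "(weight has_integral lift b - lift a) {a..b}"
proof -
  have combine: "integral {x..y} weight + integral {y..z} weight = integral {x..z} weight"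
    if "x \<le> y" "y \<le> z" for x y z
    using that weight_integrable by (intro Henstock_Kurzweil_Integration.integral_combine) auto
  have "integral {a..b} weight = lift b - lift a"
  proof (cases "0 \<le> a")
    case True
    then show ?thesis
      using combine[of 0 a b] assms by (cases "a = 0"; cases "b = 0") (auto simp: lift_def)
  next
    case False
    then show ?thesis
      using combine[of a b 0] combine[of a 0 b] assms
      by (cases "b < 0"; cases "b = 0") (auto simp: lift_def)
  qed
  then show ?thesis
    using weight_integrable[of a b] by (metis integrable_integral)
qed

lemma lift_0: "lift 0 = 0"
  by (simp add: lift_def)

lemma lift_mono: "a \<le> b \<Longrightarrow> lift a \<le> lift b"
  using has_integral_nonneg[OF lift_has_integral] weight_pos by (auto intro: less_imp_le)

lemma lift_node:
  "lift (grid n (k + 1)) - lift (grid n k) = 2 * pi / 5 ^ n * density_of (node_state n k)"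
  using lift_has_integral[of "grid n k" "grid n (k + 1)"] has_integral_weight
  by (auto simp: grid_le_iff intro: has_integral_unique)

text \<open>An interval of twice the length of a node contains a full node, namely the one after the node of its
  left end point.\<close>

lemma node_inside_interval:
  assumes "2 * (2 * pi / 5 ^ n) \<le> b - a"
  shows "a \<le> grid n (node_index n a + 1)" "grid n (node_index n a + 2) \<le> b"
  using grid_node_index[where n = n and x = a] assms grid_diff[of n "node_index n a + 2" "node_index n a"]
  by auto

lemma lift_strict_mono: "strict_mono lift"
proof (rule strict_monoI)
  fix a b :: real
  assume "a < b"
  then obtain n where n: "(1 / 5) ^ n < (b - a) / (4 * pi)"
    using real_arch_pow_inv[of "(b - a) / (4 * pi)" "1 / 5"] by auto
  define k where "k = node_index n a + 1"
  have "a \<le> grid n k" "grid n (k + 1) \<le> b"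
    using node_inside_interval[of n b a] n by (auto simp: k_def field_simps)
  moreover have "0 < lift (grid n (k + 1)) - lift (grid n k)"
    unfolding lift_node using density_of_pos by simp
  ultimately show "lift a < lift b"
    using lift_mono[of a "grid n k"] lift_mono[of "grid n (k + 1)" b] by linarith
qed

lemma lift_continuous: "continuous_on UNIV lift"
proof (rule continuous_at_imp_continuous_on, rule ballI)
  fix x
  have "continuous_on {x - 1..x + 1} (\<lambda>y. lift (x - 1) + integral {x - 1..y} weight)"
    using weight_integrable by (intro continuous_intros indefinite_integral_continuous_1)
  moreover have "lift (x - 1) + integral {x - 1..y} weight = lift y" if "y \<in> {x - 1..x + 1}" for y
    using integral_unique[OF lift_has_integral[of "x - 1" y]] that by simp
  ultimately have "continuous_on {x - 1..x + 1} lift"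
    by (rule continuous_on_eq)
  then show "isCont lift x"
    by (rule continuous_on_interior) simp
qed

lemma lift_periodic: "lift (x + 2 * pi) = lift x + 2 * pi"
proof -
  have shift: "lift (b + 2 * pi) - lift (a + 2 * pi) = lift b - lift a" if "a \<le> b" for a b
  proof -
    have "(weight has_integral lift (b + 2 * pi) - lift (a + 2 * pi)) (cbox (a + 2 * pi) (b + 2 * pi))"
      using lift_has_integral[of "a + 2 * pi" "b + 2 * pi"] that by simp
    from has_integral_affinity'[OF this, of 1 "2 * pi"]
    have "(weight has_integral lift (b + 2 * pi) - lift (a + 2 * pi)) {a..b}"
      by (simp add: weight_periodic)
    then show ?thesis
      using lift_has_integral[OF that] by (rule has_integral_unique)
  qed
  have "lift (0 + 2 * pi) - lift 0 = 2 * pi"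
    using lift_node[of 0 0] by (simp add: grid_def)
  then show ?thesis
    using shift[of 0 x] shift[of x 0] by (cases "0 \<le> x") auto
qed

lemma lift_diff_id_bounded: "\<bar>lift x - x\<bar> \<le> 2 * pi"
proof -
  have fix_grid: "lift (grid 0 k) = grid 0 k" for k
  proof (induction k rule: int_induct[where k = 0])
    case base
    then show ?case
      by (simp add: grid_def lift_0)
  next
    case (step1 i)
    then show ?case
      using lift_node[of 0 i] grid_diff[of 0 "i + 1" i] by simp
  next
    case (step2 i)
    then show ?case
      using lift_node[of 0 "i - 1"] grid_diff[of 0 i "i - 1"] by simp
  qed
  define k where "k = node_index 0 x"
  have "grid 0 k \<le> x" "x \<le> grid 0 (k + 1)"
    using grid_node_index[where n = 0 and x = x] by (auto simp: k_def)
  then show ?thesis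
    using lift_mono[of "grid 0 k" x] lift_mono[of x "grid 0 (k + 1)"] grid_diff[of 0 "k + 1" k]
    by (simp add: fix_grid)
qed

text \<open>Cut the weight off at a height \<open>c\<close>: the part above \<open>c\<close> has small integral over the whole interval if \<open>c\<close>
  is large, and the part below contributes at most \<open>c\<close> times the total length.\<close>

lemma lift_absolutely_continuous: "absolutely_continuous_on {a..b} lift"
  unfolding absolutely_continuous_on_def
proof (intro allI impI)
  fix \<epsilon> :: real
  assume \<epsilon>: "0 < \<epsilon>"
  define low where "low c x = min (weight x) (real c)" for c :: nat and x
  define high where "high c x = weight x - low c x" for c x
  have low: "low c integrable_on {u..v}" for c u v
  proof -
    have "(\<lambda>x. min (weight x) (real c)) absolutely_integrable_on {u..v}"
      using weight_integrable weight_pos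
      by (intro absolutely_integrable_min_1 nonnegative_absolutely_integrable_1)
        (auto intro: less_imp_le)
    then show ?thesis
      unfolding low_def by (rule set_lebesgue_integral_eq_integral)
  qed
  have high: "high c integrable_on {u..v}" for c u v
    unfolding high_def by (intro integrable_diff weight_integrable low)
  have high_nonneg: "0 \<le> high c x" for c x
    by (simp add: high_def low_def)
  have "(\<lambda>c. integral {a..b} (high c)) \<longlonglongrightarrow> integral {a..b} (\<lambda>x. 0)"
  proof (rule dominated_convergence(2)[OF high weight_integrable])
    show "norm (high c x) \<le> weight x" for c x
      using weight_pos[of x] by (auto simp: high_def low_def)
    show "(\<lambda>c. high c x) \<longlonglongrightarrow> 0" if "x \<in> {a..b}" for x
    proof -
      obtain c0 :: nat where "weight x \<le> real c0"
        using real_arch_simple by blast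
      then have "high c x = 0" if "c0 \<le> c" for c
        using that of_nat_mono[OF that, where 'a = real] by (simp add: high_def low_def)
      then show ?thesis
        by (intro tendsto_eventually eventually_sequentiallyI[of c0])
    qed
  qed
  then have "\<forall>\<^sub>F c in sequentially. integral {a..b} (high c) < \<epsilon> / 2"
    using \<epsilon> by (intro order_tendstoD(2)) auto
  then obtain c where c: "integral {a..b} (high c) < \<epsilon> / 2"
    using eventually_happens sequentially_bot by blast
  show "\<exists>\<delta>>0. \<forall>d T. d division_of T \<and> T \<subseteq> {a..b} \<and> (\<Sum>k\<in>d. Sup k - Inf k) < \<delta> \<longrightarrow>
      (\<Sum>k\<in>d. \<bar>lift (Sup k) - lift (Inf k)\<bar>) < \<epsilon>"
  proof (intro exI[of _ "\<epsilon> / (2 * (real c + 1))"] conjI allI impI)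
    show "0 < \<epsilon> / (2 * (real c + 1))"
      using \<epsilon> by simp
    fix d T
    assume *: "d division_of T \<and> T \<subseteq> {a..b} \<and> (\<Sum>k\<in>d. Sup k - Inf k) < \<epsilon> / (2 * (real c + 1))"
    then have d: "d division_of T" and T: "T \<subseteq> {a..b}"
      by auto
    have k: "k = {Inf k..Sup k}" "Inf k \<le> Sup k" if "k \<in> d" for k
      using division_ofD(3,4)[OF d that] by force+
    have high_k: "high c integrable_on k" if "k \<in> d" for k
      using high k(1)[OF that] by metis
    have "(\<Sum>k\<in>d. \<bar>lift (Sup k) - lift (Inf k)\<bar>)
        \<le> (\<Sum>k\<in>d. integral k (high c) + c * (Sup k - Inf k))"
    proof (rule sum_mono)
      fix k
      assume "k \<in> d"
      define u v where "u = Inf k" and "v = Sup k"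
      have uv: "k = {u..v}" "u \<le> v"
        using k[OF \<open>k \<in> d\<close>] by (auto simp: u_def v_def)
      have "integral {u..v} (\<lambda>x. high c x + low c x) = integral {u..v} (high c) + integral {u..v} (low c)"
        by (intro integral_add high low)
      then have "lift v - lift u = integral {u..v} (high c) + integral {u..v} (low c)"
        using integral_unique[OF lift_has_integral[OF uv(2)]] by (simp add: high_def)
      moreover have "integral {u..v} (low c) \<le> integral {u..v} (\<lambda>x. real c)"
        by (intro integral_le low) (auto simp: low_def)
      ultimately show "\<bar>lift (Sup k) - lift (Inf k)\<bar> \<le> integral k (high c) + c * (Sup k - Inf k)"
        using uv lift_mono[OF uv(2)] by (simp add: u_def[symmetric] v_def[symmetric] mult.commute)
    qed
    also have "\<dots> = integral T (high c) + c * (\<Sum>k\<in>d. Sup k - Inf k)"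
      using integral_combine_division_bottomup[OF d high_k]
      by (simp add: sum.distrib sum_distrib_left)
    also have "\<dots> < \<epsilon> / 2 + \<epsilon> / 2"
    proof (rule add_less_le_mono)
      have "high c integrable_on T"
        using integrable_combine_division[OF d high_k] .
      then have "integral T (high c) \<le> integral {a..b} (high c)"
        using T high high_nonneg by (intro integral_subset_le) auto
      then show "integral T (high c) < \<epsilon> / 2"
        using c by simp
      have "c * (\<Sum>k\<in>d. Sup k - Inf k) \<le> real c * (\<epsilon> / (2 * (real c + 1)))"
        using * by (intro mult_left_mono) auto
      also have "\<dots> \<le> \<epsilon> / 2"
        using \<epsilon> by (simp add: field_simps)
      finally show "c * (\<Sum>k\<in>d. Sup k - Inf k) \<le> \<epsilon> / 2" .
    qed
    finally show "(\<Sum>k\<in>d. \<bar>lift (Sup k) - lift (Inf k)\<bar>) < \<epsilon>"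
      by simp
  qed
qed

text \<open>In the interior of a stopped node the weight is constant and its primitive affine, so no general
  differentiation theorem enters.\<close>

lemma AE_lift_has_derivative: "AE x in lborel. (lift has_real_derivative weight x) (at x)"
proof -
  have "countable (\<Union>n. \<Union>k. {grid n k})"
    by auto
  then have "AE x in lborel. x \<notin> (\<Union>n. \<Union>k. {grid n k})"
    by (intro AE_not_in countable_imp_null_set_lborel)
  with AE_stopped show ?thesis
  proof eventually_elim
    case (elim x)
    then obtain n where n: "stopped (state_at n x)"
      by blast
    define k where "k = node_index n x"
    define d where "d = density_of (node_state n k)"
    have "x \<noteq> grid n k"
      using elim by blast
    then have x: "x \<in> {grid n k<..<grid n (k + 1)}"
      using grid_node_index[where n = n and x = x] by (simp add: k_def less_le)
    have stop: "stopped (node_state n k)"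
      using n by (simp add: state_at_def k_def)
    have w: "weight y = d" if "grid n k \<le> y" "y < grid n (k + 1)" for y
      using weight_stopped[of n y] state_at_eq[OF that] stop by (simp add: d_def)
    have affine: "lift (grid n k) + d * (y - grid n k) = lift y"
      if "y \<in> {grid n k<..<grid n (k + 1)}" for y
    proof -
      have "(weight has_integral d * (y - grid n k)) {grid n k..y}"
        using has_integral_const_real[of d "grid n k" y] that w
        by (subst has_integral_cong[of _ _ "\<lambda>_. d"]) (auto simp: mult.commute)
      then show ?thesis
        using lift_has_integral[of "grid n k" y] that by (force dest: has_integral_unique)
    qed
    have "((\<lambda>y. lift (grid n k) + d * (y - grid n k)) has_real_derivative d) (at x)"
      by (auto intro!: derivative_eq_intros)
    then have "(lift has_real_derivative d) (at x)"
      by (rule has_field_derivative_transform_within_open[OF _ _ x affine]) auto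
    then show ?case
      using w x by simp
  qed
qed

section \<open>Doubling\<close>

lemma density_of_near_le:
  "density_of (node_state n (k + int i)) \<le> 4 ^ i * density_of (node_state n k) \<and>
   density_of (node_state n k) \<le> 4 ^ i * density_of (node_state n (k + int i))"
proof (induction i)
  case (Suc i)
  have Suc_i: "k + int i + 1 = k + int (Suc i)"
    by simp
  have *: "density_of (node_state n (k + int (Suc i))) \<le> 4 * density_of (node_state n (k + int i))"
    "density_of (node_state n (k + int i)) \<le> 4 * density_of (node_state n (k + int (Suc i)))"
    using density_of_neighbour_le[of n "k + int i"] unfolding Suc_i by simp_all
  have "density_of (node_state n k) \<le> 4 ^ i * density_of (node_state n (k + int i))"
    using Suc by simp
  also have "\<dots> \<le> 4 ^ i * (4 * density_of (node_state n (k + int (Suc i))))"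
    using * by (intro mult_left_mono) auto
  finally show ?case
    using Suc * by (simp del: of_nat_Suc)
qed simp

lemma density_of_near_le':
  assumes "\<bar>k - l\<bar> \<le> int m"
  shows "density_of (node_state n k) \<le> 4 ^ m * density_of (node_state n l)"
proof -
  define i where "i = nat \<bar>k - l\<bar>"
  have "density_of (node_state n k) \<le> 4 ^ i * density_of (node_state n l)"
  proof (cases "k \<le> l")
    case True
    then show ?thesis
      using density_of_near_le[of n k i] by (simp add: i_def)
  next
    case False
    then show ?thesis
      using density_of_near_le[of n l i] by (simp add: i_def)
  qed
  also have "\<dots> \<le> 4 ^ m * density_of (node_state n l)"
    using assms density_of_pos by (intro mult_right_mono power_increasing) (auto simp: i_def less_imp_le)
  finally show ?thesis .
qed

lemma lift_grid_increment:
  "lift (grid n (k + int m)) - lift (grid n k) =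
     2 * pi / 5 ^ n * (\<Sum>i<m. density_of (node_state n (k + int i)))"
proof (induction m)
  case (Suc m)
  then show ?case
    using lift_node[of n "k + int m"] by (simp add: algebra_simps)
qed simp

text \<open>Used to pass from a length \<open>t\<close> to the generation whose nodes are comparable to it.\<close>

lemma scale_exists:
  fixes t C :: real
  assumes "0 < t" "t \<le> C"
  obtains n where "C / 5 ^ n \<ge> t" "C / 5 ^ Suc n < t"
proof -
  define P where "P n \<longleftrightarrow> C / 5 ^ Suc n < t" for n
  obtain m where "(1 / 5) ^ m < t / C"
    using assms real_arch_pow_inv[of "t / C" "1 / 5"] by auto
  then have "C / 5 ^ m < t"
    using assms by (simp add: field_simps)
  moreover have "C / 5 ^ Suc m \<le> C / 5 ^ m"
    using assms by (intro divide_left_mono) auto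
  ultimately have "P m"
    by (simp add: P_def)
  then have P: "P (LEAST n. P n)"
    by (rule LeastI)
  have "C / 5 ^ (LEAST n. P n) \<ge> t"
  proof (cases "LEAST n. P n")
    case (Suc n)
    then have "\<not> P n"
      using not_less_Least[of n P] by simp
    then show ?thesis
      using Suc by (simp add: P_def)
  qed (use assms in simp)
  then show ?thesis
    using P that by (auto simp: P_def)
qed

text \<open>Choose a generation whose nodes have between a tenth and a half of the length \<open>t\<close>: then \<open>[a, a + 2t]\<close> is covered by 21 consecutive nodes and each half of it
  contains one of them. The densities of these nodes differ at most by the factor \<open>4\<^sup>2\<^sup>0\<close>.\<close>

lemma lift_doubling:
  assumes "0 < t" "t \<le> pi" "x = a \<or> x = a + t"
  shows "lift (a + 2 * t) - lift a \<le> 21 * 4 ^ 20 * (lift (x + t) - lift x)"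
proof -
  have "t \<le> 4 * pi"
    using assms pi_gt_zero by linarith
  then obtain n' where n': "4 * pi / 5 ^ n' \<ge> t" "4 * pi / 5 ^ Suc n' < t"
    using assms(1) scale_exists by blast
  define n where "n = Suc n'"
  define q where "q = node_index n a"
  define p where "p = node_index n x + 1"
  have n: "4 * pi / 5 ^ n \<le> t" "t \<le> 20 * pi / 5 ^ n"
    using n' by (auto simp: n_def)
  have q: "grid n q \<le> a" "a + 2 * t \<le> grid n (q + 21)"
    using grid_node_index[where n = n and x = a] n grid_diff[of n "q + 21" "q + 1"]
    by (auto simp: q_def)
  have p: "x \<le> grid n p" "grid n (p + 1) \<le> x + t"
    using node_inside_interval[of n "x + t" x] n by (auto simp: p_def add.commute)
  have "grid n q \<le> grid n p" "grid n (p + 1) \<le> grid n (q + 21)"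
    using p q assms by auto
  then have pq: "q \<le> p" "p \<le> q + 20"
    by (auto simp: grid_le_iff)
  have "lift (a + 2 * t) - lift a \<le> lift (grid n (q + int 21)) - lift (grid n q)"
    using lift_mono[OF q(1)] lift_mono[OF q(2)] by simp
  also have "\<dots> = 2 * pi / 5 ^ n * (\<Sum>i<21. density_of (node_state n (q + int i)))"
    by (rule lift_grid_increment)
  also have "\<dots> \<le> 2 * pi / 5 ^ n * (\<Sum>i<21::nat. 4 ^ 20 * density_of (node_state n p))"
    using pq by (intro mult_left_mono sum_mono density_of_near_le') auto
  also have "\<dots> = 21 * 4 ^ 20 * (lift (grid n (p + 1)) - lift (grid n p))"
    by (simp add: lift_node)
  also have "\<dots> \<le> 21 * 4 ^ 20 * (lift (x + t) - lift x)"
    using lift_mono[OF p(1)] lift_mono[OF p(2)] by simp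
  finally show ?thesis .
qed

section \<open>Concentration\<close>

lemma sum_int_blocks:
  fixes f :: "int \<Rightarrow> real"
  assumes "0 \<le> c"
  shows "(\<Sum>i<m. \<Sum>l\<in>{c * (k + int i)..<c * (k + int i + 1)}. f l) = (\<Sum>l\<in>{c * k..<c * (k + int m)}. f l)"
proof (induction m)
  case (Suc m)
  have *: "k + int (Suc m) = k + int m + 1"
    by simp
  have "{c * k..<c * (k + int (Suc m))} =
      {c * k..<c * (k + int m)} \<union> {c * (k + int m)..<c * (k + int m + 1)}"
    unfolding * using assms by (subst ivl_disj_un) (auto intro: mult_left_mono)
  then show ?case
    using Suc by (simp add: sum.union_disjoint ivl_disj_int)
qed simp

lemma descendant_mean_eq_sum:
  "descendant_mean r F (node_state n k) =
     (\<Sum>l\<in>{5 ^ r * k..<5 ^ r * (k + 1)}. F (node_state (n + r) l)) / 5 ^ r"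
proof (induction r arbitrary: n k)
  case 0
  have "{k..<k + 1} = {k}"
    by auto
  then show ?case
    by simp
next
  case (Suc r)
  define f where "f l = F (node_state (Suc n + r) l)" for l
  have "descendant_mean (Suc r) F (node_state n k) =
      (\<Sum>i<5. descendant_mean r F (node_state (Suc n) (5 * k + int i))) / 5"
    by (simp add: node_state_child del: node_state.simps)
  also have "\<dots> = (\<Sum>i<5. (\<Sum>l\<in>{5 ^ r * (5 * k + int i)..<5 ^ r * (5 * k + int i + 1)}. f l) / 5 ^ r) / 5"
    unfolding Suc f_def ..
  also have "\<dots> = (\<Sum>l\<in>{5 ^ r * (5 * k)..<5 ^ r * (5 * k + int 5)}. f l) / 5 ^ r / 5"
    unfolding sum_divide_distrib[symmetric] by (subst sum_int_blocks) simp_all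
  also have "{5 ^ r * (5 * k)..<5 ^ r * (5 * k + int 5)} = {5 ^ Suc r * k..<5 ^ Suc r * (k + 1)}"
    by (simp add: algebra_simps)
  finally show ?case
    by (simp add: f_def)
qed

text \<open>Take a node at which a walk with a high ceiling starts, so \<open>j = 1\<close> and \<open>m = -1\<close>, and a late generation
  below it. Let \<open>B\<close> consist of the descendants that are unstopped or have \<open>m > -1\<close>. They have small total
  length, since \<open>m\<close> increases with probability at most \<open>2\<^sup>1\<^sup>-\<^sup>N\<close> and few descendants are unstopped. The
  others have density \<open>1/2\<close>, so they carry at most half of the mass of the node, which has density
  one.\<close>

lemma concentrated_node:
  assumes "0 < \<delta>"
  obtains n k r B where "B \<subseteq> {5 ^ r * k..<5 ^ r * (k + 1)}"
    "real (card B) * (2 * pi / 5 ^ (n + r)) \<le> \<delta> * (2 * pi / 5 ^ n)"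
    "(\<Sum>l\<in>{5 ^ r * k..<5 ^ r * (k + 1)} - B. lift (grid (n + r) (l + 1)) - lift (grid (n + r) l))
       \<le> (lift (grid n (k + 1)) - lift (grid n k)) / 2"
proof -
  obtain N where N: "(1 / 2) ^ N < \<delta> / 2"
    using assms real_arch_pow_inv[of "\<delta> / 2" "1 / 2"] by auto
  obtain n k where nk: "node_state n k = Walk (Suc N) 1 (- 1)"
    using walk_exists by blast
  define s where "s = node_state n k"
  have "admissible s"
    by (simp add: s_def admissible_node_state)
  then have "\<forall>\<^sub>F r in sequentially. descendant_mean r (\<lambda>s. of_bool (\<not> stopped s)) s < \<delta> / 2"
    using assms unstopped_mean_tendsto_0 by (intro order_tendstoD(2)) auto
  then obtain r where r: "descendant_mean r (\<lambda>s. of_bool (\<not> stopped s)) s < \<delta> / 2"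
    using eventually_happens sequentially_bot by blast
  define good where "good s' \<longleftrightarrow> stopped s' \<and> base_of s' = - 1" for s'
  define D where "D = {5 ^ r * k..<5 ^ r * (k + 1)}"
  define B where "B = {l \<in> D. \<not> good (node_state (n + r) l)}"
  have "finite D" "B \<subseteq> D" "card D = 5 ^ r"
    by (auto simp: D_def B_def algebra_simps nat_power_eq)
  have "real (card B) / 5 ^ r = descendant_mean r (\<lambda>s'. of_bool (\<not> good s')) s"
    unfolding s_def descendant_mean_eq_sum D_def[symmetric]
    using \<open>finite D\<close> by (simp add: B_def of_bool_def sum.If_cases Int_def conj_commute)
  also have "\<dots> \<le> descendant_mean r
      (\<lambda>s'. of_bool (\<not> stopped s') + \<bar>real_of_int (base_of s') - base_of s\<bar>) s"
  proof (rule descendant_mean_mono[OF \<open>admissible s\<close>])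
    fix s'
    have "1 \<le> \<bar>real_of_int (base_of s') - base_of s\<bar>" if "base_of s' \<noteq> - 1"
      using that unfolding s_def nk by simp
    then show "of_bool (\<not> good s') \<le>
        of_bool (\<not> stopped s') + \<bar>real_of_int (base_of s') - base_of s\<bar>"
      by (auto simp: good_def)
  qed
  also have "\<dots> \<le> \<delta> / 2 + oscillation_potential s"
    unfolding descendant_mean_add
    using r descendant_mean_oscillation_le[OF \<open>admissible s\<close>, of r] by linarith
  also have "oscillation_potential s = (1 / 2) ^ N"
    by (simp add: s_def nk power_divide)
  finally have "real (card B) / 5 ^ r \<le> \<delta>"
    using N by simp
  then have "real (card B) \<le> \<delta> * 5 ^ r"
    by (simp add: field_simps)
  then have "real (card B) * (2 * pi / 5 ^ (n + r)) \<le> \<delta> * 5 ^ r * (2 * pi / 5 ^ (n + r))"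
    by (intro mult_right_mono) auto
  also have "\<dots> = \<delta> * (2 * pi / 5 ^ n)"
    by (simp add: power_add)
  finally have card_B: "real (card B) * (2 * pi / 5 ^ (n + r)) \<le> \<delta> * (2 * pi / 5 ^ n)" .
  have "(\<Sum>l\<in>D - B. lift (grid (n + r) (l + 1)) - lift (grid (n + r) l))
      = (\<Sum>l\<in>D - B. 2 * pi / 5 ^ (n + r) / 2)"
    by (intro sum.cong) (auto simp: lift_node B_def good_def density_of_stopped power_int_minus)
  also have "\<dots> \<le> real (card D) * (2 * pi / 5 ^ (n + r) / 2)"
    using card_mono[OF \<open>finite D\<close>, of "D - B"] by (auto intro!: divide_right_mono mult_right_mono)
  also have "\<dots> = (lift (grid n (k + 1)) - lift (grid n k)) / 2"
    unfolding lift_node nk \<open>card D = 5 ^ r\<close> by (simp add: power_add power_int_minus)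
  finally show ?thesis
    using card_B \<open>B \<subseteq> D\<close> by (intro that) (simp_all add: D_def)
qed

section \<open>Arcs, lifts and arc-length integrals\<close>

lemma cis_eq_cis_iff: "cis x = cis y \<longleftrightarrow> (\<exists>n::int. x = y + 2 * pi * n)"
  using sin_cos_eq_iff[of x y] by (auto simp: complex_eq_iff)

lemma cis_inj_on: "inj_on cis {a..<a + 2 * pi}"
proof (rule inj_onI)
  fix x y
  assume *: "x \<in> {a..<a + 2 * pi}" "y \<in> {a..<a + 2 * pi}" "cis x = cis y"
  then obtain n :: int where n: "x = y + 2 * pi * n"
    using cis_eq_cis_iff by blast
  have "\<bar>x - y\<bar> < 2 * pi"
    using * by auto
  then have "2 * pi * \<bar>real_of_int n\<bar> < 2 * pi * 1"
    using n by (simp add: abs_mult)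
  then have "\<bar>real_of_int n\<bar> < 1"
    by (rule mult_left_less_imp_less) simp
  then have "n = 0"
    by linarith
  then show "x = y"
    using n by simp
qed

lemma periodic_int_multiple:
  assumes "\<And>x. f (x + 2 * pi) = f x"
  shows "f (x + 2 * pi * of_int n) = f x"
proof (induction n rule: int_induct[where k = 0])
  case (step1 i)
  then show ?case
    using assms[of "x + 2 * pi * of_int i"] by (simp add: algebra_simps)
next
  case (step2 i)
  then show ?case
    using assms[of "x + 2 * pi * of_int (i - 1)"] by (simp add: algebra_simps)
qed simp

lemma cis_Arg2pi: "norm z = 1 \<Longrightarrow> cis (Arg2pi z) = z"
  by (simp add: cis_conv_exp complex_norm_eq_1_exp)

text \<open>Periodic functions are transported to the circle by composition with \<open>Arg2pi\<close>.\<close>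

lemma periodic_Arg2pi_cis:
  assumes "\<And>x. f (x + 2 * pi) = f x"
  shows "f (Arg2pi (cis x)) = f x"
proof -
  obtain n :: int where "Arg2pi (cis x) = x + 2 * pi * n"
    using cis_Arg2pi[of "cis x"] cis_eq_cis_iff by auto
  then show ?thesis
    using periodic_int_multiple[of f, OF assms] by simp
qed

lemma cis_image_period: "cis ` {a..a + 2 * pi} = unit_circle"
proof
  show "unit_circle \<subseteq> cis ` {a..a + 2 * pi}"
  proof
    fix z :: complex
    assume "z \<in> unit_circle"
    then have z: "cis (Arg2pi z) = z"
      by (simp add: cis_Arg2pi)
    define n where "n = \<lceil>(a - Arg2pi z) / (2 * pi)\<rceil>"
    have "a \<le> Arg2pi z + 2 * pi * n" "Arg2pi z + 2 * pi * n \<le> a + 2 * pi"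
      using ceiling_correct[of "(a - Arg2pi z) / (2 * pi)"]
      unfolding n_def[symmetric] by (auto simp: field_simps)
    moreover have "cis (Arg2pi z + 2 * pi * n) = z"
      using z by (simp add: cis_mult[symmetric])
    ultimately show "z \<in> cis ` {a..a + 2 * pi}"
      by (metis atLeastAtMost_iff imageI)
  qed
qed auto

section \<open>Lifts\<close>

lemma angular_lift_image_arc:
  assumes "angular_lift h g" "a \<le> b"
  shows "h ` cis ` {a..b} = cis ` {g a..g b}"
proof -
  have g: "continuous_on {a..b} g" "strict_mono g" and h: "h (cis x) = cis (g x)" for x
    using assms by (auto simp: angular_lift_def intro: continuous_on_subset)
  have "g ` {a..b} = {g a..g b}"
  proof
    show "g ` {a..b} \<subseteq> {g a..g b}"
      using g(2) by (auto simp: strict_mono_less_eq)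
    show "{g a..g b} \<subseteq> g ` {a..b}"
      using IVT'[of g a _ b] g(1) assms(2) by fastforce
  qed
  then show ?thesis
    using h by (simp add: image_image) (metis (no_types, lifting) image_cong image_image)
qed

text \<open>The map \<open>cis\<close> from \<open>[0, 2 \<pi>]\<close> to the circle is closed, so continuity of \<open>h\<close> follows from continuity of
  \<open>cis \<circ> g\<close>; a continuous bijection of a compact space is a homeomorphism.\<close>

lemma angular_lift_homeomorphism:
  assumes "angular_lift h g"
  shows "\<exists>k. homeomorphism unit_circle unit_circle h k"
proof (rule homeomorphism_compact)
  have g: "continuous_on UNIV g" "strict_mono g" and per: "g (x + 2 * pi) = g x + 2 * pi"
    and h: "h (cis x) = cis (g x)" for x
    using assms by (auto simp: angular_lift_def)
  show "h ` unit_circle = unit_circle"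
    using angular_lift_image_arc[OF assms, of 0 "0 + 2 * pi"] per[of 0]
    by (simp only: cis_image_period) simp
  show "continuous_on unit_circle h"
    unfolding continuous_on_closed_vimage[OF closed_sphere]
  proof (intro allI impI)
    fix B :: "complex set"
    assume "closed B"
    have cont: "continuous_on {0..2 * pi} (\<lambda>x. cis (g x))"
      using g(1) by (intro continuous_intros) (auto intro: continuous_on_subset)
    have "unit_circle = cis ` {0..2 * pi}"
      using cis_image_period[of 0] by simp
    then have "h -` B \<inter> unit_circle = cis ` ((\<lambda>x. cis (g x)) -` B \<inter> {0..2 * pi})"
      using h by (simp only:) auto
    moreover have "compact ((\<lambda>x. cis (g x)) -` B \<inter> {0..2 * pi})"
      unfolding compact_eq_bounded_closed
    proof
      show "bounded ((\<lambda>x. cis (g x)) -` B \<inter> {0..2 * pi})"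
        by (rule bounded_subset[OF compact_imp_bounded[OF compact_Icc]]) auto
      show "closed ((\<lambda>x. cis (g x)) -` B \<inter> {0..2 * pi})"
        using cont \<open>closed B\<close> continuous_on_closed_vimage[OF closed_atLeastAtMost] by blast
    qed
    ultimately show "closed (h -` B \<inter> unit_circle)"
      by (simp add: compact_imp_closed compact_continuous_image continuous_on_cis continuous_on_id)
  qed
  show "inj_on h unit_circle"
  proof (rule inj_onI)
    fix z w
    assume "z \<in> unit_circle" "w \<in> unit_circle" and eq: "h z = h w"
    then have zw: "cis (Arg2pi z) = z" "cis (Arg2pi w) = w"
      by (simp_all add: cis_Arg2pi)
    then obtain n :: int where n: "g (Arg2pi z) = g (Arg2pi w) + 2 * pi * n"
      using h[of "Arg2pi z"] h[of "Arg2pi w"] eq cis_eq_cis_iff by metis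
    have "g (x + 2 * pi) - (x + 2 * pi) = g x - x" for x
      using per by simp
    then have "g (Arg2pi w + 2 * pi * n) - (Arg2pi w + 2 * pi * n) = g (Arg2pi w) - Arg2pi w"
      by (rule periodic_int_multiple)
    then have "g (Arg2pi z) = g (Arg2pi w + 2 * pi * n)"
      using n by simp
    then have "Arg2pi z = Arg2pi w + 2 * pi * n"
      using g(2) by (simp add: strict_mono_eq)
    then have "cis (Arg2pi z) = cis (Arg2pi w)"
      using cis_eq_cis_iff by blast
    then show "z = w"
      using zw by simp
  qed
qed simp

section \<open>Integration over arcs\<close>

lemma nn_integral_cis_shift:
  assumes "(\<lambda>x. F (cis x)) \<in> borel_measurable borel"
  shows "(\<integral>\<^sup>+x. F (cis x) * indicator {u + 2 * pi * of_int k..<v + 2 * pi * of_int k} x \<partial>lborel) =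
    (\<integral>\<^sup>+x. F (cis x) * indicator {u..<v} x \<partial>lborel)"
proof -
  define f where "f x = F (cis x) * indicator {u + 2 * pi * of_int k..<v + 2 * pi * of_int k} x" for x
  have [measurable]: "f \<in> borel_measurable borel"
    unfolding f_def using assms by measurable
  have "f (2 * pi * of_int k + 1 * x) = F (cis x) * indicator {u..<v} x" for x
    by (simp add: f_def cis_mult[symmetric] indicator_def add.commute)
  then have "(\<integral>\<^sup>+x. f x \<partial>lborel) = (\<integral>\<^sup>+x. F (cis x) * indicator {u..<v} x \<partial>lborel)"
    using nn_integral_real_affine[of f 1 "2 * pi * of_int k"] by simp
  then show ?thesis
    by (simp add: f_def)
qed

lemma nn_integral_split:
  fixes f :: "real \<Rightarrow> ennreal"
  assumes [measurable]: "f \<in> borel_measurable borel" and "u \<le> v" "v \<le> w"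
  shows "(\<integral>\<^sup>+x. f x * indicator {u..<w} x \<partial>lborel) =
    (\<integral>\<^sup>+x. f x * indicator {u..<v} x \<partial>lborel) + (\<integral>\<^sup>+x. f x * indicator {v..<w} x \<partial>lborel)"
  using assms by (subst nn_integral_add[symmetric]) (auto intro!: nn_integral_cong simp: indicator_def)

text \<open>At a multiple \<open>c\<close> of \<open>2 \<pi>\<close> in \<open>[a, a + 2 \<pi>]\<close> the interval is cut in two, and the left piece is moved
  to the right by one period.\<close>

lemma nn_integral_cis_period:
  assumes [measurable]: "(\<lambda>x. F (cis x)) \<in> borel_measurable borel"
  shows "(\<integral>\<^sup>+x. F (cis x) * indicator {a..<a + 2 * pi} x \<partial>lborel) =
    (\<integral>\<^sup>+x. F (cis x) * indicator {0..<2 * pi} x \<partial>lborel)"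
proof -
  define J where "J u v = (\<integral>\<^sup>+x. F (cis x) * indicator {u..<v} x \<partial>lborel)" for u v
  have shift: "J (u + 2 * pi * of_int k) (v + 2 * pi * of_int k) = J u v" for u v k
    unfolding J_def using assms by (rule nn_integral_cis_shift)
  have split: "J u w = J u v + J v w" if "u \<le> v" "v \<le> w" for u v w
    unfolding J_def using assms that by (rule nn_integral_split)
  define k where "k = \<lceil>a / (2 * pi)\<rceil>"
  define c where "c = 2 * pi * real_of_int k"
  have c: "a \<le> c" "c \<le> a + 2 * pi"
    using ceiling_correct[of "a / (2 * pi)"] unfolding k_def[symmetric] c_def by (auto simp: field_simps)
  have "J a (a + 2 * pi) = J a c + J c (a + 2 * pi)"
    using c by (rule split)
  also have "J a c = J (a + 2 * pi) (c + 2 * pi)"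
    using shift[of a 1 c] by simp
  also have "\<dots> + J c (a + 2 * pi) = J c (c + 2 * pi)"
    using c split[of c "a + 2 * pi" "c + 2 * pi"] by (simp add: add.commute)
  also have "\<dots> = J 0 (2 * pi)"
    using shift[of 0 k "2 * pi"] by (simp add: c_def add.commute)
  finally show ?thesis
    by (simp add: J_def)
qed

lemma space_arc_length_measure: "space arc_length_measure = unit_circle"
proof -
  have "{0..2 * pi} = insert (2 * pi) {0..<2 * pi}"
    by auto
  then have "cis ` {0..2 * pi} = insert (cis 0) (cis ` {0..<2 * pi})"
    by simp
  also have "\<dots> = cis ` {0..<2 * pi}"
    by (rule insert_absorb, rule imageI) simp
  finally show ?thesis
    using cis_image_period[of 0] by (simp add: arc_length_measure_def space_embed_measure)
qed

lemma measurable_arc_length_measure: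
  assumes "(\<lambda>x. f (cis x)) \<in> borel \<rightarrow>\<^sub>M N"
  shows "f \<in> arc_length_measure \<rightarrow>\<^sub>M N"
  unfolding arc_length_measure_def
proof (rule measurable_embed_measure1)
  have "(\<lambda>x. f (cis x)) \<in> lebesgue \<rightarrow>\<^sub>M N"
    using assms by (intro measurable_completion) simp
  then show "(\<lambda>x. f (cis x)) \<in> lebesgue_on {0..<2 * pi} \<rightarrow>\<^sub>M N"
    by (rule measurable_restrict_space1)
qed

lemma measurable_cis [measurable]: "cis \<in> borel_measurable borel"
  by (intro borel_measurable_continuous_onI continuous_intros)

lemma arc_borel: "cis ` {a..b} \<in> sets borel"
  by (intro borel_closed compact_imp_closed compact_continuous_image continuous_intros) simp

lemma arc_in_sets: "cis ` {a..b} \<in> sets arc_length_measure"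
proof -
  have [measurable]: "cis ` {a..b} \<in> sets borel"
    by (rule arc_borel)
  have "Measurable.pred arc_length_measure (\<lambda>z. z \<in> cis ` {a..b})"
    by (rule measurable_arc_length_measure) measurable
  then have "{z \<in> space arc_length_measure. z \<in> cis ` {a..b}} \<in> sets arc_length_measure"
    by (simp add: pred_def)
  also have "{z \<in> space arc_length_measure. z \<in> cis ` {a..b}} = cis ` {a..b}"
    by (auto simp: space_arc_length_measure)
  finally show ?thesis .
qed

text \<open>Arc length is defined with the parameter interval \<open>[0, 2 \<pi>)\<close>. Moving it to \<open>[a, a + 2 \<pi>)\<close> makes the
  preimage of the arc the single interval \<open>[a, b]\<close>, up to an end point.\<close>

lemma nn_integral_arc:
  assumes F: "(\<lambda>x. F (cis x)) \<in> borel_measurable borel" and "a < b" "b \<le> a + 2 * pi"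
  shows "(\<integral>\<^sup>+z. F z * indicator (cis ` {a..b}) z \<partial>arc_length_measure) =
    (\<integral>\<^sup>+x. F (cis x) * indicator {a..b} x \<partial>lborel)"
proof -
  define G where "G z = F z * indicator (cis ` {a..b}) z" for z
  have G: "(\<lambda>x. G (cis x)) \<in> borel_measurable borel"
  proof -
    have [measurable]: "cis ` {a..b} \<in> sets borel"
      by (rule arc_borel)
    show ?thesis
      unfolding G_def using F by measurable
  qed
  have "(\<integral>\<^sup>+z. G z \<partial>arc_length_measure) = (\<integral>\<^sup>+x. G (cis x) \<partial>lebesgue_on {0..<2 * pi})"
    using cis_inj_on[of 0] measurable_arc_length_measure[OF G] unfolding arc_length_measure_def
    by (intro nn_integral_embed_measure') simp_all
  also have "\<dots> = (\<integral>\<^sup>+x. G (cis x) * indicator {0..<2 * pi} x \<partial>lborel)"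
    by (subst nn_integral_restrict_space) (auto simp: nn_integral_completion)
  also have "\<dots> = (\<integral>\<^sup>+x. G (cis x) * indicator {a..<a + 2 * pi} x \<partial>lborel)"
    using G by (rule nn_integral_cis_period[symmetric])
  also have "\<dots> = (\<integral>\<^sup>+x. F (cis x) * indicator {a..b} x \<partial>lborel)"
  proof (rule nn_integral_cong_AE)
    have "AE x in lborel. x \<noteq> a + 2 * pi"
      by (rule AE_lborel_singleton)
    then show "AE x in lborel. G (cis x) * indicator {a..<a + 2 * pi} x = F (cis x) * indicator {a..b} x"
    proof eventually_elim
      case (elim x)
      have "cis x \<notin> cis ` {a..b}" if "x \<in> {a..<a + 2 * pi}" "x \<notin> {a..b}"
      proof
        assume "cis x \<in> cis ` {a..b}"
        then obtain y where "y \<in> {a..b}" "cis x = cis y"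
          by blast
        moreover from this have "y \<in> {a..<a + 2 * pi}"
          using that by auto
        ultimately show False
          using cis_inj_on[of a] that by (metis inj_onD)
      qed
      moreover have "x \<in> {a..<a + 2 * pi}" if "x \<in> {a..b}"
        using that elim assms by auto
      ultimately show ?case
        by (auto simp: G_def indicator_def)
    qed
  qed
  finally show ?thesis
    by (simp add: G_def)
qed

lemma emeasure_arc:
  assumes "a < b" "b \<le> a + 2 * pi"
  shows "emeasure arc_length_measure (cis ` {a..b}) = ennreal (b - a)"
  using nn_integral_arc[of "\<lambda>_. 1", OF _ assms] arc_in_sets[of a b] assms by simp

lemma arc_length_arc:
  assumes "a < b" "b \<le> a + 2 * pi"
  shows "arc_length (cis ` {a..b}) = b - a"
  using emeasure_arc[OF assms] assms by (simp add: measure_def)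

lemma finite_measure_arc_length: "finite_measure arc_length_measure"
proof
  show "emeasure arc_length_measure (space arc_length_measure) \<noteq> \<infinity>"
    using emeasure_arc[of 0 "0 + 2 * pi"] by (simp only: space_arc_length_measure cis_image_period) simp
qed

section \<open>Mean oscillation\<close>

text \<open>The mean may be replaced by any other constant \<open>c\<close> at the cost of a factor two, since the distance of
  the mean from \<open>c\<close> is at most the mean distance of \<open>u\<close> from \<open>c\<close>.\<close>

lemma mean_oscillation_le:
  fixes u :: "'a \<Rightarrow> complex"
  assumes "finite_measure M" and u: "integrable M u" and I: "I \<in> sets M" "0 < measure M I"
    and le: "(\<integral>\<^sup>+z. ennreal (norm (u z - c)) * indicator I z \<partial>M) \<le> ennreal (K * measure M I)"
    and "0 \<le> K"
  shows "set_lebesgue_integral M I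
      (\<lambda>z. norm (u z - set_lebesgue_integral M I u /\<^sub>R measure M I)) /\<^sub>R measure M I \<le> 2 * K"
proof -
  interpret finite_measure M
    by fact
  define A where "A = set_lebesgue_integral M I u /\<^sub>R measure M I"
  have int: "set_integrable M I (\<lambda>z. u z - d)" for d
    using u I unfolding set_integrable_def by (intro integrable_mult_indicator) auto
  have intn: "set_integrable M I (\<lambda>z. norm (u z - d))" for d
    using int by (rule set_integrable_norm)
  have intu: "set_integrable M I u"
    using int[of 0] by simp
  have const: "set_integrable M I (\<lambda>z. d)" "set_integrable M I (\<lambda>z. e)"
    for d :: real and e :: complex
    using I(1) unfolding set_integrable_def by (intro integrable_mult_indicator; simp)+
  have K: "set_lebesgue_integral M I (\<lambda>z. norm (u z - c)) \<le> K * measure M I"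
  proof -
    have "ennreal (set_lebesgue_integral M I (\<lambda>z. norm (u z - c))) =
        (\<integral>\<^sup>+z. ennreal (indicator I z *\<^sub>R norm (u z - c)) \<partial>M)"
      using intn[of c] unfolding set_lebesgue_integral_def set_integrable_def
      by (intro nn_integral_eq_integral[symmetric]) auto
    also have "\<dots> = (\<integral>\<^sup>+z. ennreal (norm (u z - c)) * indicator I z \<partial>M)"
      by (intro nn_integral_cong) (auto simp: indicator_def)
    also have "\<dots> \<le> ennreal (K * measure M I)"
      by (rule le)
    finally show ?thesis
      using \<open>0 \<le> K\<close> by (simp add: ennreal_le_iff)
  qed
  have "norm (A - c) \<le> K"
  proof -
    have "measure M I *\<^sub>R (A - c) = set_lebesgue_integral M I (\<lambda>z. u z - c)"
      using I set_integral_diff(2)[OF intu const(2)[of c]]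
      by (simp add: A_def scaleR_diff_right set_integral_const)
    then have "measure M I * norm (A - c) = norm (set_lebesgue_integral M I (\<lambda>z. u z - c))"
      by (metis abs_of_nonneg measure_nonneg norm_scaleR)
    also have "\<dots> \<le> K * measure M I"
      using set_integral_norm_bound[OF int] K by (rule order_trans)
    finally show ?thesis
      using I by (simp add: mult.commute)
  qed
  have "set_lebesgue_integral M I (\<lambda>z. norm (u z - A))
      \<le> set_lebesgue_integral M I (\<lambda>z. norm (u z - c) + norm (A - c))"
  proof (intro set_integral_mono set_integral_add(1) intn const(1))
    show "norm (u z - A) \<le> norm (u z - c) + norm (A - c)" for z
      using norm_triangle_ineq4[of "u z - c" "A - c"] by simp
  qed
  also have "\<dots> = set_lebesgue_integral M I (\<lambda>z. norm (u z - c)) + measure M I * norm (A - c)"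
    using intn const I(1) by (simp add: set_integral_add set_integral_const)
  also have "\<dots> \<le> K * measure M I + measure M I * K"
    using K \<open>norm (A - c) \<le> K\<close> by (intro add_mono mult_left_mono) auto
  finally show ?thesis
    using I by (simp add: A_def field_simps)
qed

section \<open>The circle homeomorphism\<close>

definition circle_map :: "complex \<Rightarrow> complex" where
  "circle_map z = cis (lift (Arg2pi z))"

definition log_deriv :: "complex \<Rightarrow> complex" where
  "log_deriv z = complex_of_real (ln (weight (Arg2pi z)))
     + \<i> * complex_of_real (lift (Arg2pi z) - Arg2pi z)"

lemma circle_map_cis: "circle_map (cis x) = cis (lift x)"
  unfolding circle_map_def
proof (rule periodic_Arg2pi_cis)
  show "cis (lift (x + 2 * pi)) = cis (lift x)" for x
    using cis_mult[of "lift x" "2 * pi"] by (simp add: lift_periodic)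
qed

lemma log_deriv_cis:
  "log_deriv (cis x) = complex_of_real (ln (weight x)) + \<i> * complex_of_real (lift x - x)"
  unfolding log_deriv_def
  by (rule periodic_Arg2pi_cis) (simp add: lift_periodic weight_periodic)

lemma angular_lift_lift: "angular_lift circle_map lift"
  by (simp add: angular_lift_def lift_continuous lift_strict_mono lift_periodic circle_map_cis)

lemma arc_length_image_arc:
  assumes "a < b" "b \<le> a + 2 * pi"
  shows "arc_length (circle_map ` cis ` {a..b}) = lift b - lift a"
proof -
  have "lift a < lift b"
    using lift_strict_mono assms(1) by (rule strict_monoD)
  moreover have "lift b \<le> lift a + 2 * pi"
    using lift_mono[OF assms(2)] by (simp add: lift_periodic)
  ultimately show ?thesis
    using angular_lift_image_arc[OF angular_lift_lift] assms(1) by (simp add: arc_length_arc)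
qed

lemma quasisymmetric_circle_map: "quasisymmetric circle_map"
  unfolding quasisymmetric_def
proof (intro exI[of _ "21 * 4 ^ 20"] conjI allI impI)
  fix I J
  assume *: "adjacent_intervals I J \<and> arc_length I = arc_length J \<and> arc_length I \<le> pi"
  then obtain a b c where abc: "a < b" "b < c" "c \<le> a + 2 * pi"
    and IJ: "I = cis ` {a..b}" "J = cis ` {b..c}"
    unfolding adjacent_intervals_def by blast
  define t where "t = b - a"
  have t: "0 < t" "t \<le> pi" "b = a + t" "c = a + 2 * t"
    using * abc by (auto simp: IJ arc_length_arc t_def)
  have I: "arc_length (circle_map ` I) = lift (a + t) - lift a"
    and J: "arc_length (circle_map ` J) = lift (a + 2 * t) - lift (a + t)"
    using abc t by (auto simp: IJ arc_length_image_arc)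
  have "lift a \<le> lift (a + t)" "lift (a + t) \<le> lift (a + 2 * t)"
    using t by (auto intro: lift_mono)
  then have
    "lift (a + t) - lift a \<le> 21 * 4 ^ 20 * (lift (a + 2 * t) - lift (a + t))"
    "lift (a + 2 * t) - lift (a + t) \<le> 21 * 4 ^ 20 * (lift (a + t) - lift a)"
    using lift_doubling[OF t(1,2), of "a + t" a] lift_doubling[OF t(1,2), of a a]
    by (simp_all add: add.assoc)
  then show "inverse (21 * 4 ^ 20) * arc_length (circle_map ` I) \<le> arc_length (circle_map ` J)"
    "arc_length (circle_map ` J) \<le> 21 * 4 ^ 20 * arc_length (circle_map ` I)"
    unfolding I J by (simp_all add: field_simps)
qed simp

lemma is_log_deriv_log_deriv: "is_log_deriv circle_map log_deriv"
  unfolding is_log_deriv_def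
proof (intro exI[of _ lift] conjI angular_lift_lift)
  have "AE x in lborel. \<exists>d>0. (lift has_real_derivative d) (at x) \<and>
      log_deriv (cis x) = complex_of_real (ln d) + \<i> * complex_of_real (lift x - x)"
    using AE_lift_has_derivative
  proof eventually_elim
    case (elim x)
    then show ?case
      using weight_pos[of x] log_deriv_cis[of x] by blast
  qed
  then show "AE x in lebesgue. \<exists>d>0. (lift has_real_derivative d) (at x) \<and>
      log_deriv (cis x) = complex_of_real (ln d) + \<i> * complex_of_real (lift x - x)"
    by (rule AE_completion)
qed

lemma measurable_lift [measurable]: "lift \<in> borel_measurable borel"
  using lift_continuous by (rule borel_measurable_continuous_onI)

lemma measurable_log_deriv_cis [measurable]: "(\<lambda>x. log_deriv (cis x)) \<in> borel_measurable borel"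
  unfolding log_deriv_cis by measurable

text \<open>An arc lies in two adjacent nodes of length less than five times its own, whose typical values
  differ at most by one. With the bound for a single node this gives three node lengths.\<close>

lemma log_weight_mean_oscillation:
  assumes "a < b" "b \<le> a + 2 * pi"
  shows "\<exists>c::real. (\<integral>\<^sup>+x. ennreal \<bar>log_weight x - c\<bar> * indicator {a..b} x \<partial>lborel)
    \<le> ennreal (15 * (b - a))"
proof -
  obtain n where n: "2 * pi / 5 ^ n \<ge> b - a" "2 * pi / 5 ^ Suc n < b - a"
    using scale_exists[of "b - a" "2 * pi"] assms by auto
  define k where "k = node_index n a"
  define c where "c l = real_of_int (base_of (node_state n l))" for l
  define Q where "Q l = {grid n l..grid n (l + 1)}" for l
  define s where "s = 2 * pi / 5 ^ n"
  have ab: "x \<in> Q k \<or> x \<in> Q (k + 1)" if "x \<in> {a..b}" for x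
    using grid_node_index[where n = n and x = a] that n(1) grid_diff[of n "k + 2" "k + 1"]
    by (auto simp: Q_def k_def add.commute)
  have "\<bar>base_of (node_state n k) - base_of (node_state n (k + 1))\<bar> \<le> 1"
    by (rule base_of_neighbour_diff)
  then have c: "\<bar>c k - c (k + 1)\<bar> \<le> 1"
    unfolding c_def by linarith
  have Q [measurable]: "Q l \<in> sets borel" for l
    by (simp add: Q_def)
  have "(\<integral>\<^sup>+x. ennreal \<bar>log_weight x - c k\<bar> * indicator {a..b} x \<partial>lborel)
      \<le> (\<integral>\<^sup>+x. (ennreal \<bar>log_weight x - c k\<bar> * indicator (Q k) x
          + ennreal \<bar>log_weight x - c (k + 1)\<bar> * indicator (Q (k + 1)) x)
          + indicator (Q (k + 1)) x \<partial>lborel)"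
  proof (rule nn_integral_mono)
    fix x
    have "ennreal \<bar>log_weight x - c k\<bar> \<le> ennreal (\<bar>log_weight x - c (k + 1)\<bar> + 1)"
      using c by (intro ennreal_leI) linarith
    then have le: "ennreal \<bar>log_weight x - c k\<bar> \<le> ennreal \<bar>log_weight x - c (k + 1)\<bar> + 1"
      by simp
    show "ennreal \<bar>log_weight x - c k\<bar> * indicator {a..b} x
      \<le> (ennreal \<bar>log_weight x - c k\<bar> * indicator (Q k) x
          + ennreal \<bar>log_weight x - c (k + 1)\<bar> * indicator (Q (k + 1)) x)
          + indicator (Q (k + 1)) x"
    proof (cases "x \<in> {a..b} \<and> x \<notin> Q k")
      case True
      then show ?thesis
        using ab[of x] le by simp
    next
      case False
      then show ?thesis
        by (auto simp: indicator_def add_increasing2 add.assoc)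
    qed
  qed
  also have "\<dots> = (\<integral>\<^sup>+x. ennreal \<bar>log_weight x - c k\<bar> * indicator (Q k) x \<partial>lborel)
      + (\<integral>\<^sup>+x. ennreal \<bar>log_weight x - c (k + 1)\<bar> * indicator (Q (k + 1)) x \<partial>lborel)
      + emeasure lborel (Q (k + 1))"
    by (simp add: nn_integral_add)
  also have "\<dots> \<le> ennreal s + ennreal s + ennreal s"
  proof (intro add_mono)
    show "emeasure lborel (Q (k + 1)) \<le> ennreal s"
      using grid_diff[of n "k + 1 + 1" "k + 1"] by (simp add: Q_def grid_le_iff s_def)
  qed (unfold s_def c_def Q_def, (rule nn_integral_log_weight_oscillation)+)
  also have "\<dots> = ennreal (3 * s)"
    by (simp add: s_def ennreal_plus[symmetric] del: ennreal_plus)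
  also have "\<dots> \<le> ennreal (15 * (b - a))"
    using n(2) by (intro ennreal_leI) (simp add: s_def)
  finally show ?thesis
    by blast
qed

text \<open>The imaginary part of the logarithm is bounded by \<open>2 \<pi>\<close>, hence harmless.\<close>

lemma log_deriv_mean_oscillation:
  assumes "a < b" "b \<le> a + 2 * pi"
  shows "\<exists>c. (\<integral>\<^sup>+z. ennreal (norm (log_deriv z - c)) * indicator (cis ` {a..b}) z \<partial>arc_length_measure)
    \<le> ennreal ((15 + 2 * pi) * arc_length (cis ` {a..b}))"
proof -
  obtain c :: real where
    c: "(\<integral>\<^sup>+x. ennreal \<bar>log_weight x - c\<bar> * indicator {a..b} x \<partial>lborel) \<le> ennreal (15 * (b - a))"
    using log_weight_mean_oscillation[OF assms] by blast
  define C where "C = complex_of_real (ln 2 * c)"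
  have le: "norm (log_deriv (cis x) - C) \<le> \<bar>log_weight x - c\<bar> + 2 * pi" for x
  proof -
    have "log_deriv (cis x) - C = complex_of_real (ln 2 * (log_weight x - c)) + \<i> * complex_of_real (lift x - x)"
      by (simp add: log_deriv_cis C_def weight_def ln_powr algebra_simps)
    then have "norm (log_deriv (cis x) - C) \<le> ln 2 * \<bar>log_weight x - c\<bar> + \<bar>lift x - x\<bar>"
      using norm_triangle_ineq[of "complex_of_real (ln 2 * (log_weight x - c))" "\<i> * complex_of_real (lift x - x)"]
      by (simp add: norm_mult abs_mult del: of_real_mult of_real_diff)
    also have "\<dots> \<le> 1 * \<bar>log_weight x - c\<bar> + 2 * pi"
      using ln_2_less_1 by (intro add_mono mult_right_mono lift_diff_id_bounded) auto
    finally show ?thesis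
      by simp
  qed
  have "(\<integral>\<^sup>+z. ennreal (norm (log_deriv z - C)) * indicator (cis ` {a..b}) z \<partial>arc_length_measure)
      = (\<integral>\<^sup>+x. ennreal (norm (log_deriv (cis x) - C)) * indicator {a..b} x \<partial>lborel)"
    by (rule nn_integral_arc[OF _ assms]) measurable
  also have "\<dots> \<le> (\<integral>\<^sup>+x. ennreal \<bar>log_weight x - c\<bar> * indicator {a..b} x
      + ennreal (2 * pi) * indicator {a..b} x \<partial>lborel)"
    using le by (intro nn_integral_mono)
      (auto simp: indicator_def ennreal_plus[symmetric] simp del: ennreal_plus intro!: ennreal_leI)
  also have "\<dots> = (\<integral>\<^sup>+x. ennreal \<bar>log_weight x - c\<bar> * indicator {a..b} x \<partial>lborel)
      + ennreal (2 * pi) * emeasure lborel {a..b}"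
    by (subst nn_integral_add) (auto simp: nn_integral_cmult_indicator)
  also have "\<dots> \<le> ennreal (15 * (b - a)) + ennreal (2 * pi) * ennreal (b - a)"
    using assms c by (intro add_mono) auto
  also have "\<dots> = ennreal ((15 + 2 * pi) * arc_length (cis ` {a..b}))"
    using assms by (simp add: arc_length_arc ennreal_mult[symmetric] ennreal_plus[symmetric] algebra_simps
        del: ennreal_plus)
  finally show ?thesis
    by blast
qed

lemma integrable_log_deriv: "integrable arc_length_measure log_deriv"
proof -
  interpret finite_measure arc_length_measure
    by (rule finite_measure_arc_length)
  have [measurable]: "log_deriv \<in> borel_measurable arc_length_measure"
    by (rule measurable_arc_length_measure) measurable
  obtain c where c: "(\<integral>\<^sup>+z. ennreal (norm (log_deriv z - c)) * indicator (cis ` {0..2 * pi}) z \<partial>arc_length_measure)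
    \<le> ennreal ((15 + 2 * pi) * arc_length (cis ` {0..2 * pi}))"
    using log_deriv_mean_oscillation[of 0 "2 * pi"] by auto
  have "integrable arc_length_measure (\<lambda>z. log_deriv z - c)"
  proof (rule integrableI_bounded)
    have "(\<integral>\<^sup>+z. ennreal (norm (log_deriv z - c)) \<partial>arc_length_measure) =
        (\<integral>\<^sup>+z. ennreal (norm (log_deriv z - c)) * indicator (cis ` {0..2 * pi}) z \<partial>arc_length_measure)"
      using cis_image_period[of 0] by (intro nn_integral_cong) (simp add: space_arc_length_measure)
    also have "\<dots> < \<infinity>"
      using c by (rule order_le_less_trans) simp
    finally show "(\<integral>\<^sup>+z. ennreal (norm (log_deriv z - c)) \<partial>arc_length_measure) < \<infinity>" .
  qed measurable
  then have "integrable arc_length_measure (\<lambda>z. (log_deriv z - c) + c)"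
    by (rule Bochner_Integration.integrable_add) simp
  then show ?thesis
    by simp
qed

lemma log_deriv_BMO: "log_deriv \<in> BMO_circle"
  unfolding BMO_circle_def
proof (intro CollectI conjI integrable_log_deriv bdd_aboveI2)
  fix I
  assume "I \<in> Collect circle_interval"
  then obtain a b where ab: "a < b" "b \<le> a + 2 * pi" "I = cis ` {a..b}"
    unfolding circle_interval_def by blast
  then obtain c where
    "(\<integral>\<^sup>+z. ennreal (norm (log_deriv z - c)) * indicator I z \<partial>arc_length_measure)
      \<le> ennreal ((15 + 2 * pi) * arc_length I)"
    using log_deriv_mean_oscillation by blast
  then show "interval_mean I (\<lambda>z. norm (log_deriv z - interval_mean I log_deriv)) \<le> 2 * (15 + 2 * pi)"
    unfolding interval_mean_def using ab
    by (intro mean_oscillation_le[OF finite_measure_arc_length integrable_log_deriv])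
      (auto simp: arc_in_sets arc_length_arc)
qed

text \<open>In the node provided by \<open>concentrated_node\<close>, the union \<open>E\<close> of the arcs of the descendants in \<open>B\<close> has
  relative length at most \<open>\<delta>\<close>. The remaining arcs cover the rest of the node and their images
  have at most half of the length of the image of the node, so the image of \<open>E\<close> has at least
  the other half, contrary to the \<open>A\<^sub>\<infinity>\<close> condition for \<open>\<epsilon> = 1/3\<close>.\<close>

lemma not_A_infinity_circle_map: "\<not> deriv_A_infinity_weight circle_map"
proof
  assume "deriv_A_infinity_weight circle_map"
  then obtain \<delta> where "0 < \<delta>"
    and \<delta>: "\<And>I E. circle_interval I \<Longrightarrow> E \<in> sets arc_length_measure \<Longrightarrow> E \<subseteq> I \<Longrightarrow>
      arc_length E \<le> \<delta> * arc_length I \<Longrightarrow>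
      arc_length (circle_map ` E) \<le> (1 / 3) * arc_length (circle_map ` I)"
    unfolding deriv_A_infinity_weight_def
    by (elim allE[of _ "1 / 3"] impE exE) auto
  interpret finite_measure arc_length_measure
    by (rule finite_measure_arc_length)
  obtain n k r B where B: "B \<subseteq> {5 ^ r * k..<5 ^ r * (k + 1)}"
    and card_B: "real (card B) * (2 * pi / 5 ^ (n + r)) \<le> \<delta> * (2 * pi / 5 ^ n)"
    and rest: "(\<Sum>l\<in>{5 ^ r * k..<5 ^ r * (k + 1)} - B. lift (grid (n + r) (l + 1)) - lift (grid (n + r) l))
       \<le> (lift (grid n (k + 1)) - lift (grid n k)) / 2"
    by (rule concentrated_node[OF \<open>0 < \<delta>\<close>])
  define D where "D = {5 ^ r * k..<5 ^ r * (k + 1)}"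
  define A where "A l = cis ` {grid (n + r) l..grid (n + r) (l + 1)}" for l
  define I where "I = cis ` {grid n k..grid n (k + 1)}"
  define E where "E = (\<Union>l\<in>B. A l)"
  define R where "R = (\<Union>l\<in>D - B. A l)"
  have fin: "finite B" "finite (D - B)"
    using B finite_subset by (auto simp: D_def)
  have small: "grid m l < grid m (l + 1)" "grid m (l + 1) \<le> grid m l + 2 * pi"
    and len: "grid m (l + 1) - grid m l = 2 * pi / 5 ^ m" for m l
  proof -
    have "2 * pi / 5 ^ m \<le> 2 * pi / 1"
      by (intro divide_left_mono) auto
    then show "grid m l < grid m (l + 1)" "grid m (l + 1) \<le> grid m l + 2 * pi"
      "grid m (l + 1) - grid m l = 2 * pi / 5 ^ m"
      using grid_diff[of m "l + 1" l] by (auto simp: grid_less_iff)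
  qed
  have coarse: "grid (n + r) (5 ^ r * l) = grid n l" for l
    by (simp add: grid_def power_add)
  have sub: "A l \<subseteq> I" if "l \<in> D" for l
  proof -
    have "grid n k \<le> grid (n + r) l" "grid (n + r) (l + 1) \<le> grid n (k + 1)"
      using that unfolding coarse[symmetric] by (auto simp: grid_le_iff D_def)
    then show ?thesis
      unfolding A_def I_def by (intro image_mono) auto
  qed
  have "I \<subseteq> E \<union> R"
  proof
    fix z
    assume "z \<in> I"
    then obtain x where x: "z = cis x" "grid n k \<le> x" "x \<le> grid n (k + 1)"
      by (auto simp: I_def)
    \<comment> \<open>The right end point of the arc belongs to the first node after it, hence the minimum.\<close>
    define l where "l = min (node_index (n + r) x) (5 ^ r * (k + 1) - 1)"
    have node: "grid (n + r) (node_index (n + r) x) \<le> x" "x < grid (n + r) (node_index (n + r) x + 1)"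
      using grid_node_index by auto
    have "grid (n + r) (5 ^ r * k) < grid (n + r) (node_index (n + r) x + 1)"
      using x(2) node(2) unfolding coarse by linarith
    then have "5 ^ r * k \<le> node_index (n + r) x"
      by (simp add: grid_less_iff)
    then have "l \<in> D"
      by (auto simp: D_def l_def algebra_simps)
    moreover have "grid (n + r) l \<le> x"
      using node(1) grid_le_iff[of "n + r" l "node_index (n + r) x"] by (auto simp: l_def)
    moreover have "x \<le> grid (n + r) (l + 1)"
    proof (cases "l = node_index (n + r) x")
      case False
      then have "l + 1 = 5 ^ r * (k + 1)"
        by (auto simp: l_def min_def split: if_splits)
      then show ?thesis
        using x(3) coarse[of "k + 1"] by simp
    qed (use node(2) in simp)
    ultimately have "z \<in> A l" "l \<in> B \<or> l \<in> D - B"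
      by (auto simp: A_def x(1))
    then show "z \<in> E \<union> R"
      unfolding E_def R_def by blast
  qed
  have A_image: "circle_map ` A l = cis ` {lift (grid (n + r) l)..lift (grid (n + r) (l + 1))}" for l
    unfolding A_def using small(1) by (intro angular_lift_image_arc[OF angular_lift_lift]) (simp add: less_imp_le)
  have sets: "A l \<in> sets arc_length_measure" "circle_map ` A l \<in> sets arc_length_measure" for l
    unfolding A_image by (auto simp: A_def arc_in_sets)
  have E_image: "circle_map ` E = (\<Union>l\<in>B. circle_map ` A l)"
    and R_image: "circle_map ` R = (\<Union>l\<in>D - B. circle_map ` A l)"
    by (auto simp: E_def R_def)
  have E_sets: "E \<in> sets arc_length_measure" "circle_map ` E \<in> sets arc_length_measure"
    unfolding E_image using fin sets by (auto simp: E_def)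
  have R_sets: "circle_map ` R \<in> sets arc_length_measure"
    unfolding R_image using fin sets by auto
  have "arc_length E \<le> (\<Sum>l\<in>B. arc_length (A l))"
    unfolding E_def using fin sets by (intro finite_measure_subadditive_finite) auto
  also have "\<dots> = real (card B) * (2 * pi / 5 ^ (n + r))"
    using small len by (simp add: A_def arc_length_arc)
  also have "\<dots> \<le> \<delta> * arc_length I"
    using card_B small len by (simp add: I_def arc_length_arc)
  finally have "arc_length E \<le> \<delta> * arc_length I" .
  moreover have "circle_interval I"
    unfolding circle_interval_def I_def using small by blast
  moreover have "E \<subseteq> I"
    using sub B unfolding E_def D_def by blast
  ultimately have third: "arc_length (circle_map ` E) \<le> (1 / 3) * arc_length (circle_map ` I)"
    using \<delta> E_sets by blast
  have "arc_length (circle_map ` R) \<le> (\<Sum>l\<in>D - B. arc_length (circle_map ` A l))"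
    unfolding R_image using fin sets by (intro finite_measure_subadditive_finite) auto
  also have "\<dots> = (\<Sum>l\<in>D - B. lift (grid (n + r) (l + 1)) - lift (grid (n + r) l))"
    using small by (simp add: A_def arc_length_image_arc)
  also have "\<dots> \<le> arc_length (circle_map ` I) / 2"
    using rest small by (simp add: D_def I_def arc_length_image_arc)
  finally have half: "arc_length (circle_map ` R) \<le> arc_length (circle_map ` I) / 2" .
  have "circle_map ` I \<subseteq> circle_map ` E \<union> circle_map ` R"
    using \<open>I \<subseteq> E \<union> R\<close> by blast
  then have "arc_length (circle_map ` I) \<le> arc_length (circle_map ` E \<union> circle_map ` R)"
    using E_sets R_sets by (intro finite_measure_mono) auto
  also have "\<dots> \<le> arc_length (circle_map ` E) + arc_length (circle_map ` R)"
    using E_sets R_sets by (intro measure_Un_le) auto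
  finally have "arc_length (circle_map ` I) \<le> (1 / 3 + 1 / 2) * arc_length (circle_map ` I)"
    using third half by simp
  moreover have "0 < arc_length (circle_map ` I)"
    using small lift_strict_mono by (simp add: I_def arc_length_image_arc strict_mono_less)
  ultimately show False
    by simp
qed

theorem theorem1:
  shows "\<exists>h. sense_preserving_circle_homeomorphism h \<and>
             circle_absolutely_continuous h \<and>
             deriv_doubling_weight h \<and>
             (\<exists>u. is_log_deriv h u \<and> u \<in> BMO_circle) \<and>
             \<not> deriv_A_infinity_weight h"
proof (rule exI[of _ circle_map], intro conjI)
  show "sense_preserving_circle_homeomorphism circle_map"
    unfolding sense_preserving_circle_homeomorphism_def
    using angular_lift_homeomorphism angular_lift_lift by blast
  show "circle_absolutely_continuous circle_map"
    unfolding circle_absolutely_continuous_def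
    using angular_lift_lift lift_absolutely_continuous by blast
  show "deriv_doubling_weight circle_map"
    unfolding deriv_doubling_weight_def by (rule quasisymmetric_circle_map)
  show "\<exists>u. is_log_deriv circle_map u \<and> u \<in> BMO_circle"
    using is_log_deriv_log_deriv log_deriv_BMO by blast
  show "\<not> deriv_A_infinity_weight circle_map"
    by (rule not_A_infinity_circle_map)
qed

end
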